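(* Let $a\geq 5$ and let $D$ be a strongly connected balanced bipartite digraph of order $2a$ which is not (isomorphic to) the directed cycle of length $2a$. Suppose that $\max\{d(x),d(y)\}\geq 2a-2$ for every dominating pair of vertices $\{x,y\}$ of $D$. Then $D$ contains a cycle of length $2a-2$, unless $D$ is isomorphic to the digraph $D(10)$ (of order $10$) defined in the context.
   Context: Digraphs are finite, without loops and without multiple arcs (but both arcs $xy$ and $yx$ may be present). For vertices $x,y$, write $x\rightarrow y$ if $xy$ is an arc, and $x\leftrightarrow y$ if both $x\rightarrow y$ and $y\rightarrow x$; for disjoint vertex sets $A,B$, $A\rightarrow B$ means every vertex of $A$ dominates every vertex of $B$ (i.e. $x\rightarrow y$ for all $x\in A$, $y\in B$). The order of a digraph is its number of vertices. The degree of $x$ is $d(x)=d^+(x)+d^-(x)$, the sum of its out-degree and in-degree. Cycles are directed cycles with distinct vertices; a cycle of length $2$ is a pair $x\leftrightarrow y$. A digraph is bipartite if its vertex set can be partitioned into two partite sets $X,Y$ such that every arc has its end-vertices in different partite sets; it is balanced if $|X|=|Y|$. A digraph is strongly connected if for every ordered pair of distinct vertices $(x,y)$ there is a directed path from $x$ to $y$. A pair $\{x,y\}$ of distinct vertices is called dominating if there is a vertex $z$ with $x\rightarrow z$ and $y\rightarrow z$. The digraph $D(10)$: it is the bipartite digraph with partite sets $X=\{x_0,x_1,x_2,x_3,x_4\}$ and $Y=\{y_0,y_1,y_2,y_3,y_4\}$ whose arcs are exactly the following: $x_i\leftrightarrow y_j$ for all $i\in\{1,2,3\}$, $j\in\{0,1\}$;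 $\{x_1,x_2,x_3\}\rightarrow\{y_2,y_3,y_4\}$; $x_4\leftrightarrow y_1$; $x_0\leftrightarrow y_0$; and $x_i\leftrightarrow y_{i+1}$ for $i\in\{1,2,3\}$. It has no other arcs. *)

theory Defs
  imports "Graph_Theory.Graph_Theory"
begin

definition bipartition :: "('a, 'b) pre_digraph \<Rightarrow> 'a set \<Rightarrow> 'a set \<Rightarrow> bool" where
  "bipartition G X Y \<longleftrightarrow>
     verts G = X \<union> Y \<and> X \<inter> Y = {} \<and>
     (\<forall>e \<in> arcs G. (tail G e \<in> X \<and> head G e \<in> Y) \<or> (tail G e \<in> Y \<and> head G e \<in> X))"

definition balanced_bipartite :: "('a, 'b) pre_digraph \<Rightarrow> bool" where
  "balanced_bipartite G \<longleftrightarrow> (\<exists>X Y. bipartition G X Y \<and> card X = card Y)"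

definition degree :: "('a, 'b) pre_digraph \<Rightarrow> 'a \<Rightarrow> nat" where
  "degree G v = out_degree G v + in_degree G v"

definition dominating_pair :: "('a, 'b) pre_digraph \<Rightarrow> 'a \<Rightarrow> 'a \<Rightarrow> bool" where
  "dominating_pair G x y \<longleftrightarrow>
     x \<in> verts G \<and> y \<in> verts G \<and> x \<noteq> y \<and>
     (\<exists>z \<in> verts G. x \<rightarrow>\<^bsub>G\<^esub> z \<and> y \<rightarrow>\<^bsub>G\<^esub> z)"

definition directed_cycle :: "nat \<Rightarrow> (nat, nat \<times> nat) pre_digraph" where
  "directed_cycle n =
     with_proj \<lparr> pverts = {..<n}, parcs = {(i, Suc i mod n) | i. i < n} \<rparr>"

datatype D10_vertex = x nat | y nat

definition both_arcs :: "'a \<Rightarrow> 'a \<Rightarrow> 'a rel" where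
  "both_arcs u v = {(u, v), (v, u)}"

definition D10 :: "(D10_vertex, D10_vertex \<times> D10_vertex) pre_digraph" where
  "D10 = with_proj
     \<lparr> pverts = x ` {0, 1, 2, 3, 4} \<union> y ` {0, 1, 2, 3, 4},
       parcs =
         (\<Union>i \<in> {1, 2, 3}. \<Union>j \<in> {0, 1}. both_arcs (x i) (y j)) \<union>
         x ` {1, 2, 3} \<times> y ` {2, 3, 4} \<union>
         both_arcs (x 4) (y 1) \<union>
         both_arcs (x 0) (y 0) \<union>
         (\<Union>i \<in> {1, 2, 3}. both_arcs (x i) (y (i + 1))) \<rparr>"

hide_const (open) x y

end

(* Call a vertex high if its degree is at least 2a - 2, and low otherwise. Two low vertices never
   dominate a common vertex, so low vertices of one side have disjoint out-neighbourhoods; as a high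
   vertex misses at most two arcs, each side has at most three low vertices (if all vertices were
   low, the digraph would be a directed cycle). The high vertices induce an almost complete bipartite
   digraph. A cycle of length at least 6 that leaves out at most one low vertex of each side can
   be extended by inserting pairs of high vertices until it has length 2a - 2. Such an initial cycle
   is found by distinguishing the numbers of low vertices on the two sides; strong connectivity is
   used to route it through the low vertices. It fails to exist only if one side has three and the
   other side two low vertices, and then the digraph is D(10). *)
theory Submission
  imports Defs
begin

section \<open>Cycles as vertex lists\<close>

text \<open>A cycle of length \<open>2 * a - 2\<close> omits exactly one vertex of each side, and
  the extension adds only high vertices; this is why an initial cycle may omit at most one low
  vertex per side. All forcing is a budget argument: a high vertex lacks at most two of its 2a
  possible arcs. Three low vertices on one side use up this budget at every high vertex opposite,
  since at most one of them dominates it; two low vertices use up at least one arc of it; a single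
  one need not use up any. So the fewer low vertices there are, the less is forced. With three, the
  remaining arcs at the high vertices opposite are determined and only the low vertices have to be
  routed. With at most one per side, a 6-cycle has to be found among the double arcs between high
  vertices, or by a way back through low ones. D(10) is what remains when routing fails for three
  and two low vertices: the excluded detours leave only two high vertices beside the three low ones,
  so a = 5.\<close>

definition cyc :: "('a \<Rightarrow> 'a \<Rightarrow> bool) \<Rightarrow> 'a list \<Rightarrow> bool" where
  "cyc E p \<longleftrightarrow> p \<noteq> [] \<and> distinct p \<and> successively E p \<and> E (last p) (hd p)"

lemma cyc_conv_nth:
  "cyc E p \<longleftrightarrow> p \<noteq> [] \<and> distinct p \<and> (\<forall>i<length p. E (p ! i) (p ! (Suc i mod length p)))"
proof (cases "p = []")
  case False
  define n where "n = length p - 1"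
  have len: "length p = Suc n"
    using False by (simp add: n_def)
  have "(\<forall>i<Suc n. E (p ! i) (p ! (Suc i mod Suc n))) \<longleftrightarrow>
      (\<forall>i<n. E (p ! i) (p ! (Suc i mod Suc n))) \<and> E (p ! n) (p ! (Suc n mod Suc n))"
    by (subst All_less_Suc) (rule conj_commute)
  also have "\<dots> \<longleftrightarrow> (\<forall>i<n. E (p ! i) (p ! Suc i)) \<and> E (p ! n) (p ! 0)"
    by (metis Suc_less_eq mod_less mod_self)
  finally have "(\<forall>i<Suc n. E (p ! i) (p ! (Suc i mod Suc n))) \<longleftrightarrow>
      (\<forall>i<n. E (p ! i) (p ! Suc i)) \<and> E (p ! n) (p ! 0)" .
  then show ?thesis
    using False by (simp add: cyc_def successively_conv_nth len last_conv_nth hd_conv_nth less_diff_conv)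
qed (simp add: cyc_def)

lemma cyc_rotate1: "cyc E p \<Longrightarrow> cyc E (rotate1 p)"
  by (cases p) (auto simp: cyc_def successively_append_iff successively_Cons hd_append)

lemma cyc_rotate: "cyc E p \<Longrightarrow> cyc E (rotate n p)"
  by (induction n) (simp_all add: cyc_rotate1)

text \<open>Rotating the list until \<open>p ! i\<close> is its last entry turns the insertion into
  appending \<open>[s, t]\<close>.\<close>

lemma cyc_insert:
  assumes "cyc E p" "i < length p" "s \<notin> set p" "t \<notin> set p" "s \<noteq> t"
    and "E (p ! i) s" "E s t" "E t (p ! (Suc i mod length p))"
  shows "\<exists>q. cyc E q \<and> set q = {s, t} \<union> set p"
proof -
  define q where "q = rotate (Suc i) p"
  have p: "p \<noteq> []"
    using assms(1) by (simp add: cyc_def)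
  have q: "cyc E q" "q \<noteq> []" "set q = set p"
    using cyc_rotate[OF assms(1), of "Suc i"] p by (simp_all add: q_def del: rotate_Suc)
  have "hd q = p ! (Suc i mod length p)"
    using p by (simp add: q_def hd_rotate_conv_nth del: rotate_Suc)
  moreover have "last q = p ! i"
  proof -
    have "last q = p ! ((Suc i + (length p - 1)) mod length p)"
      using p q(2) unfolding q_def
      by (subst last_conv_nth) (simp_all add: nth_rotate del: rotate_Suc)
    also have "Suc i + (length p - 1) = i + length p"
      using p by (cases p) auto
    finally show ?thesis
      using assms(2) by simp
  qed
  ultimately have "cyc E (q @ [s, t])"
    using q assms by (auto simp: cyc_def successively_append_iff)
  then show ?thesis
    using q(3) by (intro exI[of _ "q @ [s, t]"]) auto
qed

text \<open>Renaming \<open>w\<close> to \<open>s\<close> preserves every arc of the cycle, since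
  irreflexivity at \<open>w\<close> excludes an arc that is renamed at both ends.\<close>

lemma cyc_replace:
  assumes "cyc E p" "w \<in> set p" "s \<notin> set p" "\<not> E w w"
    and "\<And>u. u \<in> set p \<Longrightarrow> E u w \<Longrightarrow> E u s"
    and "\<And>u. u \<in> set p \<Longrightarrow> E w u \<Longrightarrow> E s u"
  shows "\<exists>q. cyc E q \<and> set q = insert s (set p - {w})"
proof -
  define f where "f v = (if v = w then s else v)" for v
  have inj: "inj_on f (set p)"
    using assms(3) by (auto simp: inj_on_def f_def)
  have "E (f (p ! i)) (f (p ! (Suc i mod length p)))" if "i < length p" for i
  proof -
    have "E (p ! i) (p ! (Suc i mod length p))" "p ! i \<in> set p" "p ! (Suc i mod length p) \<in> set p"
      using assms(1) that by (auto simp: cyc_conv_nth)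
    then show ?thesis
      using assms(4-6) by (auto simp: f_def)
  qed
  then have "cyc E (map f p)"
    using assms(1) inj by (auto simp: cyc_conv_nth distinct_map)
  moreover have "set (map f p) = insert s (set p - {w})"
    using assms(2) by (auto simp: f_def)
  ultimately show ?thesis
    by blast
qed

lemma inj_on_Suc_mod: "inj_on (\<lambda>i. Suc i mod n) {..<n}"
  by (auto simp: inj_on_def mod_Suc split: if_splits)

lemma inj_on_succ_nth:
  assumes "distinct p"
  shows "inj_on (\<lambda>i. p ! (Suc i mod length p)) {..<length p}"
proof (rule inj_onI)
  fix i j
  assume ij: "i \<in> {..<length p}" "j \<in> {..<length p}"
    and "p ! (Suc i mod length p) = p ! (Suc j mod length p)"
  then have "Suc i mod length p = Suc j mod length p"
    by (subst (asm) nth_eq_iff_index_eq[OF assms]) (auto intro!: mod_less_divisor)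
  then show "i = j"
    by (rule inj_onD[OF inj_on_Suc_mod _ ij])
qed

lemma obtain2:
  assumes "2 \<le> card (S :: 'a set)"
  obtains s t where "s \<in> S" "t \<in> S" "s \<noteq> t"
  using assms by (metis One_nat_def card_2_iff' obtain_subset_with_card_n subset_iff)

lemma obtain_other:
  assumes "2 \<le> card (S :: 'a set)"
  obtains s where "s \<in> S" "s \<noteq> t"
proof -
  from assms obtain r s where "r \<in> S" "s \<in> S" "r \<noteq> s"
    by (rule obtain2)
  then show ?thesis
    using that[of r] that[of s] by auto
qed

lemma obtain_third:
  assumes "3 \<le> card (S :: 'a set)"
  obtains r where "r \<in> S" "r \<noteq> s" "r \<noteq> t"
proof -
  have "\<not> S \<subseteq> {s, t}"
    using assms card_mono[of "{s, t}" S] card_insert_le_m1[of 2 "{t}" s] by auto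
  then show ?thesis
    using that by auto
qed

lemma card_le_2_subset:
  assumes "card S \<le> 2" "finite S" "(s :: 'a) \<in> S"
  obtains d where "S \<subseteq> {s, d}"
proof (cases "S \<subseteq> {s}")
  case False
  then obtain d where d: "d \<in> S" "d \<noteq> s"
    by blast
  then have "{s, d} = S"
    using assms by (intro card_seteq) auto
  then show ?thesis
    using that by blast
qed (use that in blast)

lemma pair_cover: "S = {s, t} \<Longrightarrow> r \<in> S \<Longrightarrow> \<exists>c. S \<subseteq> {r, c}"
  by auto

section \<open>High vertices\<close>

definition hi :: "('a \<Rightarrow> 'a \<Rightarrow> bool) \<Rightarrow> nat \<Rightarrow> 'a \<Rightarrow> bool" where
  "hi E a v \<longleftrightarrow> 2 * a - 2 \<le> card {w. E v w} + card {w. E w v}"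

text \<open>\<open>S\<close> and \<open>T\<close> stand for the sets of low vertices of the two sides. The bound \<open>6\<close> on the
  length is what makes the insertion argument below work.\<close>

definition near_cyc :: "('a \<Rightarrow> 'a \<Rightarrow> bool) \<Rightarrow> nat \<Rightarrow> 'a set \<Rightarrow> 'a set \<Rightarrow> bool" where
  "near_cyc E a S T \<longleftrightarrow> (\<exists>p. cyc E p \<and> 6 \<le> length p \<and> length p \<le> 2 * a - 2 \<and>
     card (S - set p) \<le> 1 \<and> card (T - set p) \<le> 1)"

lemma near_cyc_swap: "near_cyc E a S T \<Longrightarrow> near_cyc E a T S"
  by (auto simp: near_cyc_def)

text \<open>In the labelling of \<open>D10\<close>, the vertices \<open>u\<^sub>i\<close> are \<open>y\<^sub>2, y\<^sub>3, y\<^sub>4\<close>, the vertices \<open>p\<^sub>i\<close> are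
  \<open>y\<^sub>0, y\<^sub>1\<close>, the vertices \<open>y\<^sub>i\<close> are \<open>x\<^sub>1, x\<^sub>2, x\<^sub>3\<close>, and the vertices \<open>v\<^sub>i\<close> are \<open>x\<^sub>0, x\<^sub>4\<close>.\<close>

definition d10_arc :: "'a \<Rightarrow> 'a \<Rightarrow> 'a \<Rightarrow> 'a \<Rightarrow> 'a \<Rightarrow> 'a \<Rightarrow> 'a \<Rightarrow> 'a \<Rightarrow> 'a \<Rightarrow> 'a \<Rightarrow> 'a \<Rightarrow> 'a \<Rightarrow> bool" where
  "d10_arc u1 u2 u3 p1 p2 y1 y2 y3 v1 v2 s t \<longleftrightarrow>
     s \<in> {p1, p2} \<and> t \<in> {y1, y2, y3} \<or> s \<in> {y1, y2, y3} \<and> t \<in> {p1, p2, u1, u2, u3} \<or>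
     (s, t) \<in> {(u1, y1), (u2, y2), (u3, y3), (p1, v1), (v1, p1), (p2, v2), (v2, p2)}"

lemma eq_d10_arcI:
  assumes dist: "distinct [u1, u2, u3, p1, p2, y1, y2, y3, v1, v2]"
    and bip: "\<And>s t. E s t \<Longrightarrow> s \<in> {u1, u2, u3, p1, p2} \<and> t \<in> {y1, y2, y3, v1, v2} \<or>
      s \<in> {y1, y2, y3, v1, v2} \<and> t \<in> {u1, u2, u3, p1, p2}"
    and "\<And>z. z \<in> {u1, u2, u3, p1, p2} \<Longrightarrow> E y1 z \<and> E y2 z \<and> E y3 z"
    and "E p1 y1" "E p1 y2" "E p1 y3" "E p2 y1" "E p2 y2" "E p2 y3"
    and "E u1 y1" "\<not> E u1 y2" "\<not> E u1 y3" "\<not> E u2 y1" "E u2 y2" "\<not> E u2 y3" "\<not> E u3 y1" "\<not> E u3 y2" "E u3 y3"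
    and "\<And>s w. s \<in> {u1, u2, u3} \<Longrightarrow> w \<in> {v1, v2} \<Longrightarrow> \<not> E s w \<and> \<not> E w s"
    and "E p1 v1" "E v1 p1" "E p2 v2" "E v2 p2" "\<not> E p1 v2" "\<not> E v2 p1" "\<not> E p2 v1" "\<not> E v1 p2"
  shows "E = d10_arc u1 u2 u3 p1 p2 y1 y2 y3 v1 v2"
proof (intro ext)
  fix s t
  let ?X = "{u1, u2, u3, p1, p2}" and ?Y = "{y1, y2, y3, v1, v2}"
  \<comment> \<open>The reversed list supplies every inequality in the opposite orientation, so that
    rewriting can decide each comparison of two of the ten vertices.\<close>
  have dist': "distinct (rev [u1, u2, u3, p1, p2, y1, y2, y3, v1, v2])"
    using dist by (simp only: distinct_rev)
  have ground: "\<forall>s\<in>?X. \<forall>t\<in>?Y. (E s t \<longleftrightarrow> d10_arc u1 u2 u3 p1 p2 y1 y2 y3 v1 v2 s t) \<and>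
      (E t s \<longleftrightarrow> d10_arc u1 u2 u3 p1 p2 y1 y2 y3 v1 v2 t s)"
    using dist dist' by (simp add: d10_arc_def assms(3-))
  show "E s t = d10_arc u1 u2 u3 p1 p2 y1 y2 y3 v1 v2 s t"
  proof (cases "s \<in> ?X \<and> t \<in> ?Y \<or> s \<in> ?Y \<and> t \<in> ?X")
    case True
    then show ?thesis
      using ground by blast
  next
    case False
    moreover have "\<not> d10_arc u1 u2 u3 p1 p2 y1 y2 y3 v1 v2 s t"
      using False by (auto simp: d10_arc_def)
    ultimately show ?thesis
      using bip by blast
  qed
qed
text \<open>Not symmetric in the two sides: \<open>X\<close> is the side with three low vertices,
  which is the side Y in the labelling of \<open>D10\<close>. The final result therefore allows both
  orders.\<close>

definition is_d10 :: "('a \<Rightarrow> 'a \<Rightarrow> bool) \<Rightarrow> 'a set \<Rightarrow> 'a set \<Rightarrow> bool" where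
  "is_d10 E X Y \<longleftrightarrow> (\<exists>u1 u2 u3 p1 p2 y1 y2 y3 v1 v2.
     X = {u1, u2, u3, p1, p2} \<and> Y = {y1, y2, y3, v1, v2} \<and>
     distinct [u1, u2, u3, p1, p2, y1, y2, y3, v1, v2] \<and>
     E = d10_arc u1 u2 u3 p1 p2 y1 y2 y3 v1 v2)"

text \<open>Strong connectivity enters in cut form: every proper nonempty vertex set has a leaving
  arc. \<open>ex_hi\<close> takes the place of excluding the directed cycle. All assumptions are
  symmetric in the sides, so each result is also available with \<open>X\<close> and
  \<open>Y\<close> exchanged.\<close>

locale dom_bip =
  fixes E :: "'a \<Rightarrow> 'a \<Rightarrow> bool" and X Y :: "'a set" and a :: nat
  assumes finite_X: "finite X" and finite_Y: "finite Y"
    and card_X: "card X = a" and card_Y: "card Y = a"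
    and a_ge_5: "5 \<le> a" and disjoint: "X \<inter> Y = {}"
    and bip: "E u v \<Longrightarrow> u \<in> X \<and> v \<in> Y \<or> u \<in> Y \<and> v \<in> X"
    and strong: "S \<noteq> {} \<Longrightarrow> S \<subseteq> X \<union> Y \<Longrightarrow> S \<noteq> X \<union> Y \<Longrightarrow> \<exists>u\<in>S. \<exists>v. v \<notin> S \<and> E u v"
    and dom: "E u w \<Longrightarrow> E v w \<Longrightarrow> u \<noteq> v \<Longrightarrow> hi E a u \<or> hi E a v"
    and ex_hi: "\<exists>v \<in> X \<union> Y. hi E a v"
begin

abbreviation "H S \<equiv> {v \<in> S. hi E a v}"
abbreviation "L S \<equiv> {v \<in> S. \<not> hi E a v}"

lemma swap: "dom_bip E Y X a"
  using finite_X finite_Y card_X card_Y a_ge_5 disjoint bip strong dom ex_hi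
  by unfold_locales (auto simp: Un_commute)

lemma E_XY: "E u v \<Longrightarrow> u \<in> X \<Longrightarrow> v \<in> Y" and E_YX: "E u v \<Longrightarrow> u \<in> Y \<Longrightarrow> v \<in> X"
  and E_XY': "E u v \<Longrightarrow> v \<in> X \<Longrightarrow> u \<in> Y" and E_YX': "E u v \<Longrightarrow> v \<in> Y \<Longrightarrow> u \<in> X"
  using bip disjoint by blast+

lemma finite_HL [simp]: "finite (H X)" "finite (L X)" "finite (H Y)" "finite (L Y)"
  using finite_X finite_Y by auto

lemma card_HL: "card (H X) + card (L X) = a"
proof -
  have "X = H X \<union> L X" "H X \<inter> L X = {}"
    by auto
  then show ?thesis
    using card_X finite_HL by (metis card_Un_disjoint)
qed

lemma hi_missing:
  assumes "x \<in> X" "hi E a x"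
  shows "card {y \<in> Y. \<not> E x y} + card {y \<in> Y. \<not> E y x} \<le> 2"
proof -
  have "card {w. E x w} + card {y \<in> Y. \<not> E x y} = a"
  proof -
    have "{w. E x w} \<union> {y \<in> Y. \<not> E x y} = Y"
      using E_XY assms(1) by auto
    then show ?thesis
      using card_Y finite_Y by (metis (no_types, lifting) card_Un_disjoint disjoint_iff finite_Un mem_Collect_eq)
  qed
  moreover have "card {w. E w x} + card {y \<in> Y. \<not> E y x} = a"
  proof -
    have "{w. E w x} \<union> {y \<in> Y. \<not> E y x} = Y"
      using E_XY' assms(1) by auto
    then show ?thesis
      using card_Y finite_Y by (metis (no_types, lifting) card_Un_disjoint disjoint_iff finite_Un mem_Collect_eq)
  qed
  ultimately show ?thesis
    using assms(2) a_ge_5 by (auto simp: hi_def)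
qed

text \<open>At most two arcs at \<open>x\<close> are missing, so one of any three possible arcs is
  present. The four statements are the splits into out-arcs and in-arcs; in the mixed ones
  \<open>r\<close> may be \<open>p\<close> or \<open>q\<close>, because opposite arcs count
  separately.\<close>

lemma hi_three:
  assumes "x \<in> X" "hi E a x" "p \<in> Y" "q \<in> Y" "p \<noteq> q" "r \<in> Y"
  shows "E x p \<or> E x q \<or> E r x" "E p x \<or> E q x \<or> E x r"
    and "r \<noteq> p \<Longrightarrow> r \<noteq> q \<Longrightarrow> E x p \<or> E x q \<or> E x r"
    and "r \<noteq> p \<Longrightarrow> r \<noteq> q \<Longrightarrow> E p x \<or> E q x \<or> E r x"
proof -
  note m = hi_missing[OF assms(1,2)]
  let ?O = "{y \<in> Y. \<not> E x y}" and ?I = "{y \<in> Y. \<not> E y x}"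
  have f: "finite ?O" "finite ?I"
    using finite_Y by auto
  have le: "S \<subseteq> ?O \<Longrightarrow> T \<subseteq> ?I \<Longrightarrow> card S + card T \<le> 2" for S T
    using m card_mono[OF f(1), of S] card_mono[OF f(2), of T] by linarith
  show "E x p \<or> E x q \<or> E r x"
    using le[of "{p, q}" "{r}"] assms by auto
  show "E p x \<or> E q x \<or> E x r"
    using le[of "{r}" "{p, q}"] assms by auto
  show "E x p \<or> E x q \<or> E x r" if "r \<noteq> p" "r \<noteq> q"
    using le[of "{p, q, r}" "{}"] assms that by auto
  show "E p x \<or> E q x \<or> E r x" if "r \<noteq> p" "r \<noteq> q"
    using le[of "{}" "{p, q, r}"] assms that by auto
qed

lemma low_eq: "E u w \<Longrightarrow> E v w \<Longrightarrow> \<not> hi E a u \<Longrightarrow> \<not> hi E a v \<Longrightarrow> u = v"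
  using dom by blast

text \<open>At most one of four low vertices dominates a given high \<open>y\<close>; the other
  three would be missing arcs into \<open>y\<close>, one too many.\<close>

lemma card_low_le3_aux:
  assumes "H Y \<noteq> {}"
  shows "card (L X) \<le> 3"
proof (rule ccontr)
  assume "\<not> card (L X) \<le> 3"
  then obtain S where S: "S \<subseteq> L X" "card S = 4" and fin: "finite S"
    using obtain_subset_with_card_n[of 4 "L X"] by auto
  obtain y where y: "y \<in> Y" "hi E a y"
    using assms by auto
  interpret sw: dom_bip E Y X a by (rule swap)
  have "card {x \<in> X. \<not> E x y} \<le> 2"
    using sw.hi_missing[OF y] by simp
  moreover have "card {x \<in> S. E x y} \<le> 1"
  proof -
    have "finite {x \<in> S. E x y}"
      using fin by simp
    then have "card {x \<in> S. E x y} \<le> Suc 0 \<longleftrightarrow> (\<forall>u\<in>{x \<in> S. E x y}. \<forall>v\<in>{x \<in> S. E x y}. u = v)"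
      by (rule card_le_Suc0_iff_eq)
    then show ?thesis
      using S(1) low_eq by fastforce
  qed
  moreover have "card {x \<in> S. \<not> E x y} \<le> card {x \<in> X. \<not> E x y}"
    using S(1) finite_X by (intro card_mono) auto
  moreover have "card S = card {x \<in> S. E x y} + card {x \<in> S. \<not> E x y}"
  proof -
    have "S = {x \<in> S. E x y} \<union> {x \<in> S. \<not> E x y}" "{x \<in> S. E x y} \<inter> {x \<in> S. \<not> E x y} = {}"
      by auto
    then show ?thesis
      using fin by (metis (no_types, lifting) card_Un_disjoint finite_Un)
  qed
  ultimately show False
    using S(2) by linarith
qed

lemma card_low_le3: "card (L X) \<le> 3" and card_low_le3': "card (L Y) \<le> 3"
proof -
  interpret sw: dom_bip E Y X a by (rule swap)
  \<comment> \<open>A high vertex on one side bounds the low vertices of the other, which by a >= 5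
    then contains a high vertex itself and bounds the first side.\<close>
  have "card (L X) \<le> 3 \<or> card (L Y) \<le> 3"
    using ex_hi card_low_le3_aux sw.card_low_le3_aux by blast
  then have "H X \<noteq> {} \<or> H Y \<noteq> {}" "card (L X) \<le> 3 \<longrightarrow> H X \<noteq> {}" "card (L Y) \<le> 3 \<longrightarrow> H Y \<noteq> {}"
    using card_HL sw.card_HL a_ge_5 ex_hi by fastforce+
  then show "card (L X) \<le> 3" "card (L Y) \<le> 3"
    using card_low_le3_aux sw.card_low_le3_aux by blast+
qed

lemma out_ex: "v \<in> X \<union> Y \<Longrightarrow> \<exists>w. E v w"
proof -
  assume v: "v \<in> X \<union> Y"
  have "card (X \<union> Y) = 2 * a"
    using finite_X finite_Y disjoint card_X card_Y by (simp add: card_Un_disjoint)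
  then have "{v} \<noteq> X \<union> Y"
    using a_ge_5 by (auto dest: arg_cong[of _ _ card])
  then show ?thesis
    using strong[of "{v}"] v by auto
qed

section \<open>Extending a cycle\<close>

lemma irrefl: "\<not> E v v"
  using bip disjoint by blast

lemma cyc_subset: "cyc E p \<Longrightarrow> set p \<subseteq> X \<union> Y"
  using bip by (fastforce simp: cyc_conv_nth in_set_conv_nth)

text \<open>The successor map along the cycle is injective and takes vertices of \<open>Y\<close> to
  vertices of \<open>X\<close>.\<close>

lemma cyc_card_le:
  assumes "cyc E p"
  shows "card (set p \<inter> Y) \<le> card (set p \<inter> X)"
proof -
  let ?n = "length p"
  let ?I = "{i. i < ?n \<and> p ! i \<in> Y}"
  have "set p \<inter> Y = (\<lambda>i. p ! i) ` ?I"
    by (auto simp: in_set_conv_nth)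
  then have "card (set p \<inter> Y) \<le> card ?I"
    by (simp add: card_image_le)
  also have "card ?I \<le> card (set p \<inter> X)"
  proof (rule card_inj_on_le)
    show "inj_on (\<lambda>i. p ! (Suc i mod ?n)) ?I"
      using assms by (intro inj_on_subset[OF inj_on_succ_nth]) (auto simp: cyc_def)
    show "(\<lambda>i. p ! (Suc i mod ?n)) ` ?I \<subseteq> set p \<inter> X"
      using assms E_YX by (auto simp: cyc_conv_nth)
  qed (use finite_X in auto)
  finally show ?thesis .
qed

lemma cyc_card: "cyc E p \<Longrightarrow> card (set p \<inter> X) = card (set p \<inter> Y)"
  using cyc_card_le dom_bip.cyc_card_le[OF swap] by (simp add: antisym)

lemma cyc_length:
  assumes "cyc E p"
  shows "length p = 2 * card (set p \<inter> X)"
proof -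
  have "set p = (set p \<inter> X) \<union> (set p \<inter> Y)"
    using cyc_subset[OF assms] by auto
  then have "card (set p) = card (set p \<inter> X) + card (set p \<inter> Y)"
    using disjoint by (metis (no_types, lifting) card_Un_disjoint finite_Int finite_set inf.right_idem inf_assoc inf_bot_right inf_commute)
  then show ?thesis
    using assms cyc_card[OF assms] by (simp add: cyc_def distinct_card)
qed

text \<open>The candidate places are the vertices of \<open>Y\<close> on the cycle, each with its
  successor. A missing arc into \<open>x\<close> or out of \<open>y\<close> blocks only one place,
  so fewer missing arcs than places leave one free.\<close>

lemma insert_arc:
  assumes p: "cyc E p" and xy: "x \<in> X" "y \<in> Y" "x \<notin> set p" "y \<notin> set p" "E x y"
    and less: "card {w \<in> set p \<inter> Y. \<not> E w x} + card {w \<in> set p \<inter> X. \<not> E y w} < card (set p \<inter> Y)"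
  shows "\<exists>q. cyc E q \<and> set q = {x, y} \<union> set p"
proof -
  let ?n = "length p"
  let ?I = "{i. i < ?n \<and> p ! i \<in> Y}"
  let ?B1 = "{i \<in> ?I. \<not> E (p ! i) x}" and ?B2 = "{i \<in> ?I. \<not> E y (p ! (Suc i mod ?n))}"
  have inj1: "inj_on (\<lambda>i. p ! i) ?I"
    using p by (auto simp: inj_on_def cyc_def nth_eq_iff_index_eq)
  have inj2: "inj_on (\<lambda>i. p ! (Suc i mod ?n)) ?I"
    using p by (intro inj_on_subset[OF inj_on_succ_nth]) (auto simp: cyc_def)
  have "set p \<inter> Y = (\<lambda>i. p ! i) ` ?I"
    by (auto simp: in_set_conv_nth)
  then have "card (set p \<inter> Y) \<le> card ?I"
    by (simp add: card_image_le)
  moreover have "card ?B1 \<le> card {w \<in> set p \<inter> Y. \<not> E w x}"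
    using inj1 by (intro card_inj_on_le[of "\<lambda>i. p ! i"]) (auto simp: inj_on_def)
  moreover have "card ?B2 \<le> card {w \<in> set p \<inter> X. \<not> E y w}"
    using inj2 p E_YX
    by (intro card_inj_on_le[of "\<lambda>i. p ! (Suc i mod ?n)"]) (auto simp: inj_on_def cyc_conv_nth)
  moreover have "card (?B1 \<union> ?B2) \<le> card ?B1 + card ?B2"
    by (rule card_Un_le)
  ultimately have "card (?B1 \<union> ?B2) < card ?I"
    using less by linarith
  then have "\<not> ?I \<subseteq> ?B1 \<union> ?B2"
    using card_mono[of "?B1 \<union> ?B2" ?I] by auto
  then obtain i where "i < ?n" "E (p ! i) x" "E y (p ! (Suc i mod ?n))"
    by auto
  then show ?thesis
    using p xy disjoint by (intro cyc_insert[of E p i]) auto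
qed

text \<open>The missing arcs at \<open>x\<close> and \<open>y\<close> number at most four in total, so one of the two orientations
  \<open>x \<rightarrow> y\<close>, \<open>y \<rightarrow> x\<close> is blocked at no more than two of the at least three places on the cycle.\<close>

lemma insert_high_pair:
  assumes p: "cyc E p" "3 \<le> card (set p \<inter> X)"
    and xy: "x \<in> H X" "y \<in> H Y" "x \<notin> set p" "y \<notin> set p" "E x y \<or> E y x"
  shows "\<exists>q. cyc E q \<and> set q = {x, y} \<union> set p"
proof -
  interpret sw: dom_bip E Y X a by (rule swap)
  let ?ox = "{w \<in> set p \<inter> Y. \<not> E x w}" and ?ix = "{w \<in> set p \<inter> Y. \<not> E w x}"
  let ?oy = "{w \<in> set p \<inter> X. \<not> E y w}" and ?iy = "{w \<in> set p \<inter> X. \<not> E w y}"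
  \<comment> \<open>\<open>?c\<close> charges an absent arc between \<open>x\<close> and
    \<open>y\<close> themselves: it lies off the cycle but still consumes the budgets of both
    vertices.\<close>
  let ?c = "\<lambda>P. if P then 0 else 1 :: nat"
  have le: "card {w \<in> S. \<not> P w} + ?c (P v) \<le> card {w \<in> T. \<not> P w}"
    if "S \<subseteq> T" "finite T" "v \<in> T" "v \<notin> S" for S T :: "'a set" and P v
  proof (cases "P v")
    case True
    then show ?thesis
      using that by (auto intro!: card_mono)
  next
    case False
    have "card (insert v {w \<in> S. \<not> P w}) \<le> card {w \<in> T. \<not> P w}"
      using that False by (intro card_mono) auto
    then show ?thesis
      using False that by (auto dest: finite_subset)
  qed
  have "card ?ox + ?c (E x y) + (card ?ix + ?c (E y x)) \<le> 2"
    using le[of "set p \<inter> Y" Y y "E x"] le[of "set p \<inter> Y" Y y "\<lambda>w. E w x"]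
      hi_missing[of x] xy finite_Y by auto
  moreover have "card ?oy + ?c (E y x) + (card ?iy + ?c (E x y)) \<le> 2"
    using le[of "set p \<inter> X" X x "E y"] le[of "set p \<inter> X" X x "\<lambda>w. E w y"]
      sw.hi_missing[of y] xy finite_X by auto
  ultimately have "E x y \<and> card ?ix + card ?oy \<le> 2 \<or> E y x \<and> card ?iy + card ?ox \<le> 2"
    using xy(5) by (auto split: if_splits)
  then show ?thesis
    using insert_arc[of p x y] sw.insert_arc[of p y x] p xy cyc_card[OF p(1)]
    by (auto simp: insert_commute)
qed

text \<open>If the only high vertices off the cycle are a nonadjacent pair \<open>x\<close>, \<open>y\<close>, then \<open>x\<close> and \<open>y\<close> have all
  other arcs, and \<open>x\<close> can first be exchanged for a high vertex of the cycle.\<close>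

lemma extend_near_cyc_step:
  assumes p: "cyc E p" "3 \<le> card (set p \<inter> X)" "card (set p \<inter> X) < a - 1"
    and low: "card (L X - set p) \<le> 1" "card (L Y - set p) \<le> 1"
  shows "\<exists>q. cyc E q \<and> card (set q \<inter> X) = Suc (card (set p \<inter> X)) \<and>
    card (L X - set q) \<le> 1 \<and> card (L Y - set q) \<le> 1"
proof -
  interpret sw: dom_bip E Y X a by (rule swap)
  \<comment> \<open>Here \<open>r\<close> will be \<open>p\<close> itself or \<open>p\<close> after
    one high vertex of \<open>X\<close> has been exchanged, so both visit the same vertices of
    \<open>Y\<close> and the same low vertices of \<open>X\<close>.\<close>
  have *: "\<exists>q. cyc E q \<and> card (set q \<inter> X) = Suc (card (set p \<inter> X)) \<and>
      card (L X - set q) \<le> 1 \<and> card (L Y - set q) \<le> 1"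
    if r: "cyc E r" "L X \<inter> set p \<subseteq> set r" "set r \<inter> Y = set p \<inter> Y"
      and xy: "x \<in> H X" "y \<in> H Y" "x \<notin> set r" "y \<notin> set r" "E x y \<or> E y x" for r x y
  proof -
    have card: "card (set r \<inter> X) = card (set p \<inter> X)"
      using cyc_card[OF r(1)] cyc_card[OF p(1)] r(3) by simp
    then obtain q where q: "cyc E q" "set q = {x, y} \<union> set r"
      using insert_high_pair[OF r(1) _ xy] p(2) by auto
    have "set q \<inter> X = insert x (set r \<inter> X)"
      using q(2) xy disjoint by auto
    then have "card (set q \<inter> X) = Suc (card (set p \<inter> X))"
      using xy card finite_X by simp
    moreover have "L X - set q \<subseteq> L X - set p" "L Y - set q \<subseteq> L Y - set p"
      using r q(2) xy disjoint by auto
    then have "card (L X - set q) \<le> 1" "card (L Y - set q) \<le> 1"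
      using low card_mono[of "L X - set p" "L X - set q"] card_mono[of "L Y - set p" "L Y - set q"]
      by (auto intro: le_trans)
    ultimately show ?thesis
      using q(1) by blast
  qed
  have "card (X - set p) \<ge> 2"
    using p(3) card_X finite_X card_Diff_subset_Int[of X "set p"] by (simp add: Int_commute)
  moreover have X: "X - set p = (H X - set p) \<union> (L X - set p)"
    by auto
  ultimately have "card (H X - set p) + card (L X - set p) \<ge> 2"
    using card_Un_le[of "H X - set p" "L X - set p"] by auto
  note cX = this
  then obtain x where x: "x \<in> H X" "x \<notin> set p"
    using low(1) by (cases "H X - set p = {}") auto
  have "card (Y - set p) \<ge> 2"
    using p(3) cyc_card[OF p(1)] card_Y finite_Y card_Diff_subset_Int[of Y "set p"]
    by (simp add: Int_commute)
  moreover have "Y - set p = (H Y - set p) \<union> (L Y - set p)"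
    by auto
  ultimately have "card (H Y - set p) + card (L Y - set p) \<ge> 2"
    using card_Un_le[of "H Y - set p" "L Y - set p"] by auto
  then obtain y where y: "y \<in> H Y" "y \<notin> set p"
    using low(2) by (cases "H Y - set p = {}") auto
  show ?thesis
  proof (cases "E x y \<or> E y x")
    case True
    then show ?thesis
      using *[of p x y] p(1) x y by blast
  next
    case False
    have x_adj: "E x w" "E w x" if "w \<in> Y" "w \<noteq> y" for w
      using hi_three[of x y w y] hi_three[of x w y y] False x y that by auto
    have y_adj: "E y w" "E w y" if "w \<in> X" "w \<noteq> x" for w
      using sw.hi_three[of y x w x] sw.hi_three[of y w x x] False x y that by auto
    show ?thesis
    proof (cases "\<exists>x'. x' \<in> H X \<and> x' \<notin> set p \<and> x' \<noteq> x")
      case True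
      then obtain x' where "x' \<in> H X" "x' \<notin> set p" "x' \<noteq> x"
        by blast
      then show ?thesis
        using *[of p x' y] p(1) y y_adj[of x'] by blast
    next
      case no: False
      then have "H X - set p = {x}"
        using x by auto
      \<comment> \<open>Of the two or more vertices of \<open>X\<close> off the cycle only
        \<open>x\<close> is high. So at most two of the three possible low vertices are on the
        cycle, and among its three or more vertices of \<open>X\<close> one is high.\<close>
      then have "L X - set p \<noteq> {}"
        using cX by (metis One_nat_def Suc_1 add.right_neutral card.empty is_singletonI is_singleton_altdef not_less_eq_eq order_refl)
      then have "card (L X \<inter> set p) < card (L X)"
        by (intro psubset_card_mono) auto
      then have "card (L X \<inter> set p) < 3"
        using card_low_le3 by simp
      then have "\<not> set p \<inter> X \<subseteq> L X \<inter> set p"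
        using p(2) card_mono[of "L X \<inter> set p" "set p \<inter> X"] by auto
      then obtain x' where x': "x' \<in> H X" "x' \<in> set p"
        by auto
      have "\<exists>q. cyc E q \<and> set q = insert x (set p - {x'})"
        using x y x' p(1) x_adj irrefl E_XY E_XY'
        by (intro cyc_replace) (auto, metis+)
      then obtain r where r: "cyc E r" "set r = insert x (set p - {x'})"
        by blast
      show ?thesis
        using r x y x' y_adj[of x'] disjoint by (intro *[of r x' y]) auto
    qed
  qed
qed

lemma near_cyc_imp_cyc:
  assumes "near_cyc E a (L X) (L Y)"
  shows "\<exists>p. cyc E p \<and> length p = 2 * a - 2"
proof -
  have "\<exists>q. cyc E q \<and> card (set q \<inter> X) = a - 1"
    if "cyc E p" "3 \<le> card (set p \<inter> X)" "card (set p \<inter> X) \<le> a - 1"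
      "card (L X - set p) \<le> 1" "card (L Y - set p) \<le> 1" for p
    using that
  proof (induction "a - 1 - card (set p \<inter> X)" arbitrary: p)
    case 0
    then show ?case
      by (intro exI[of _ p]) linarith
  next
    case (Suc m)
    then have "card (set p \<inter> X) < a - 1"
      by linarith
    then obtain q where "cyc E q" "card (set q \<inter> X) = Suc (card (set p \<inter> X))"
      "card (L X - set q) \<le> 1" "card (L Y - set q) \<le> 1"
      using extend_near_cyc_step[of p] Suc.prems by blast
    then show ?case
      using Suc.prems Suc.hyps(2) by (intro Suc.hyps(1)[of q]) linarith+
  qed
  moreover obtain p where p: "cyc E p" "6 \<le> length p" "length p \<le> 2 * a - 2"
    "card (L X - set p) \<le> 1" "card (L Y - set p) \<le> 1"
    using assms by (auto simp: near_cyc_def)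
  moreover have "3 \<le> card (set p \<inter> X)" "card (set p \<inter> X) \<le> a - 1"
    using p(2,3) cyc_length[OF p(1)] by linarith+
  ultimately obtain q where "cyc E q" "card (set q \<inter> X) = a - 1"
    by blast
  then show ?thesis
    using cyc_length[of q] by auto
qed

section \<open>Near-cycles of length 6, 8 and 10 given by explicit vertices\<close>

lemma distinct_sides: "x \<in> X \<Longrightarrow> y \<in> Y \<Longrightarrow> x \<noteq> y" "x \<in> X \<Longrightarrow> y \<in> Y \<Longrightarrow> y \<noteq> x"
  using disjoint by auto

text \<open>\<open>c\<close> and \<open>d\<close> stand for the one low vertex of each side that the
  cycle may omit. Alternation fixes the sides of all other vertices once \<open>x1\<close> lies in
  \<open>X\<close>.\<close>

lemma near_cycI6:
  assumes "E x1 y1" "E y1 x2" "E x2 y2" "E y2 x3" "E x3 y3" "E y3 x1"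
    and "x1 \<in> X" "distinct [x1, x2, x3]" "distinct [y1, y2, y3]"
    and "L X \<subseteq> {x1, x2, x3, c}" "L Y \<subseteq> {y1, y2, y3, d}"
  shows "near_cyc E a (L X) (L Y)"
proof -
  let ?p = "[x1, y1, x2, y2, x3, y3]"
  note y1 = E_XY[OF assms(1) assms(7)]
  note x2 = E_YX[OF assms(2) y1]
  note y2 = E_XY[OF assms(3) x2]
  note x3 = E_YX[OF assms(4) y2]
  note y3 = E_XY[OF assms(5) x3]
  have "cyc E ?p"
    using assms(1-9) x2 x3 y1 y2 y3
    by (simp add: cyc_def distinct_sides)
  moreover have "card (L X - set ?p) \<le> card {c}"
    using assms by (intro card_mono) auto
  moreover have "card (L Y - set ?p) \<le> card {d}"
    using assms by (intro card_mono) auto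
  ultimately show ?thesis
    using a_ge_5 unfolding near_cyc_def by (intro exI[of _ ?p]) auto
qed

lemma near_cycI8:
  assumes "E x1 y1" "E y1 x2" "E x2 y2" "E y2 x3" "E x3 y3" "E y3 x4" "E x4 y4" "E y4 x1"
    and "x1 \<in> X" "distinct [x1, x2, x3, x4]" "distinct [y1, y2, y3, y4]"
    and "L X \<subseteq> {x1, x2, x3, x4, c}" "L Y \<subseteq> {y1, y2, y3, y4, d}"
  shows "near_cyc E a (L X) (L Y)"
proof -
  let ?p = "[x1, y1, x2, y2, x3, y3, x4, y4]"
  note y1 = E_XY[OF assms(1) assms(9)]
  note x2 = E_YX[OF assms(2) y1]
  note y2 = E_XY[OF assms(3) x2]
  note x3 = E_YX[OF assms(4) y2]
  note y3 = E_XY[OF assms(5) x3]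
  note x4 = E_YX[OF assms(6) y3]
  note y4 = E_XY[OF assms(7) x4]
  have "cyc E ?p"
    using assms(1-11) x2 x3 x4 y1 y2 y3 y4
    by (simp add: cyc_def distinct_sides)
  moreover have "card (L X - set ?p) \<le> card {c}"
    using assms by (intro card_mono) auto
  moreover have "card (L Y - set ?p) \<le> card {d}"
    using assms by (intro card_mono) auto
  ultimately show ?thesis
    using a_ge_5 unfolding near_cyc_def by (intro exI[of _ ?p]) auto
qed

text \<open>The bound on \<open>a\<close> is exactly what makes 10 at most
  \<open>2 * a - 2\<close>.\<close>

lemma near_cycI10:
  assumes "E x1 y1" "E y1 x2" "E x2 y2" "E y2 x3" "E x3 y3" "E y3 x4" "E x4 y4" "E y4 x5" "E x5 y5" "E y5 x1"
    and "x1 \<in> X" "distinct [x1, x2, x3, x4, x5]" "distinct [y1, y2, y3, y4, y5]" "6 \<le> a"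
    and "L X \<subseteq> {x1, x2, x3, x4, x5, c}" "L Y \<subseteq> {y1, y2, y3, y4, y5, d}"
  shows "near_cyc E a (L X) (L Y)"
proof -
  let ?p = "[x1, y1, x2, y2, x3, y3, x4, y4, x5, y5]"
  note y1 = E_XY[OF assms(1) assms(11)]
  note x2 = E_YX[OF assms(2) y1]
  note y2 = E_XY[OF assms(3) x2]
  note x3 = E_YX[OF assms(4) y2]
  note y3 = E_XY[OF assms(5) x3]
  note x4 = E_YX[OF assms(6) y3]
  note y4 = E_XY[OF assms(7) x4]
  note x5 = E_YX[OF assms(8) y4]
  note y5 = E_XY[OF assms(9) x5]
  have "cyc E ?p"
    using assms(1-13) x2 x3 x4 x5 y1 y2 y3 y4 y5
    by (simp add: cyc_def distinct_sides)
  moreover have "card (L X - set ?p) \<le> card {c}"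
    using assms by (intro card_mono) auto
  moreover have "card (L Y - set ?p) \<le> card {d}"
    using assms by (intro card_mono) auto
  ultimately show ?thesis
    using a_ge_5 \<open>6 \<le> a\<close> unfolding near_cyc_def by (intro exI[of _ ?p]) auto
qed

section \<open>Three low vertices on one side\<close>

text \<open>At most one of the three low vertices dominates \<open>y\<close>, so two arcs into
  \<open>y\<close> are missing already. No further arc at \<open>y\<close> can be missing, in
  particular not the third one from a low vertex.\<close>

lemma three_low:
  assumes L: "L X = {u1, u2, u3}" "distinct [u1, u2, u3]" and y: "y \<in> H Y"
  shows "x \<in> X \<Longrightarrow> E y x" "x \<in> H X \<Longrightarrow> E x y" "E u1 y \<or> E u2 y \<or> E u3 y"
proof -
  interpret sw: dom_bip E Y X a by (rule swap)
  have u: "u1 \<in> L X" "u2 \<in> L X" "u3 \<in> L X"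
    using L by auto
  obtain u u' where uu: "u \<in> L X" "u' \<in> L X" "u \<noteq> u'" "\<not> E u y" "\<not> E u' y"
  proof (cases "E u1 y")
    case True
    then show ?thesis
      using that[of u2 u3] low_eq[of u1 y u2] low_eq[of u1 y u3] u L(2) by auto
  next
    case False
    then show ?thesis
      using that[of u1 u2] that[of u1 u3] low_eq[of u2 y u3] u L(2) by auto
  qed
  show "x \<in> X \<Longrightarrow> E y x"
    using sw.hi_three(2)[of y u u' x] uu y by auto
  show "x \<in> H X \<Longrightarrow> E x y"
    using sw.hi_three(4)[of y u u' x] uu y by auto
  show "E u1 y \<or> E u2 y \<or> E u3 y"
    using sw.hi_three(4)[of y u1 u2 u3] u y L(2) by auto
qed

lemma two_high: "2 \<le> card (H X)" "2 \<le> card (H Y)"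
  using card_HL dom_bip.card_HL[OF swap] card_low_le3 card_low_le3' a_ge_5 by linarith+

text \<open>Since \<open>u\<^sub>2\<close> and \<open>u\<^sub>3\<close> send arcs only to low vertices, strong connectivity yields paths
  \<open>u\<^sub>i \<rightarrow> w\<^sub>i \<rightarrow> p\<^sub>i\<close> that can be spliced.\<close>

lemma one_exit_aux:
  assumes L: "L X = {u1, u2, u3}" "distinct [u1, u2, u3]"
    and out: "\<And>w. E u2 w \<Longrightarrow> \<not> hi E a w" "\<And>w. E u3 w \<Longrightarrow> \<not> hi E a w"
    and p3: "E u3 w3" "E w3 p3" "p3 \<noteq> u2" "p3 \<noteq> u3"
  shows "near_cyc E a (L X) (L Y)"
proof -
  interpret sw: dom_bip E Y X a by (rule swap)
  have u: "u1 \<in> X" "u2 \<in> X" "u3 \<in> X" "\<not> hi E a u1" "\<not> hi E a u2" "\<not> hi E a u3"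
    using L(1) by auto
  note d = L(2)
  have to: "E y x" if "y \<in> H Y" "x \<in> X" for x y
    using three_low[OF L that(1)] that by auto
  have fro: "E x y" if "y \<in> H Y" "x \<in> H X" for x y
    using three_low[OF L that(1)] that by auto
  have u1: "E u1 y" if "y \<in> H Y" for y
    using three_low(3)[OF L that] out that by auto
  \<comment> \<open>An arc leaving \<open>u2\<close> together with its out-neighbourhood can only
    start at an out-neighbour of \<open>u2\<close>.\<close>
  have "\<exists>w2 p2. E u2 w2 \<and> E w2 p2 \<and> p2 \<noteq> u2"
  proof -
    let ?S = "insert u2 {w. E u2 w}"
    have "?S \<subseteq> X \<union> Y"
      using u E_XY by auto
    moreover have "u1 \<notin> ?S"
      using u d E_XY distinct_sides by auto
    ultimately obtain s t where "s \<in> ?S" "t \<notin> ?S" "E s t"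
      using strong[of ?S] u by auto
    then show ?thesis
      by auto
  qed
  then obtain w2 p2 where p2: "E u2 w2" "E w2 p2" "p2 \<noteq> u2"
    by blast
  have w: "w2 \<in> L Y" "w3 \<in> L Y"
    using p2 p3 out E_XY u by auto
  have p: "p2 \<in> X" "p3 \<in> X"
    using p2 p3 w E_YX by auto
  have "w2 \<noteq> w3"
    using p2 p3 low_eq[of u2 w2 u3] u d by auto
  then have "p2 \<noteq> p3"
    using p2 p3 low_eq[of w2 p2 w3] w by auto
  obtain dd where LY: "L Y \<subseteq> {w2, w3, dd}"
  proof -
    have "card (L Y - {w2, w3}) \<le> 1"
      using card_low_le3' w \<open>w2 \<noteq> w3\<close> by (simp add: card_Diff_subset)
    then have "L Y - {w2, w3} = {} \<or> (\<exists>z. L Y - {w2, w3} = {z})"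
      by (metis card_0_eq card_1_singletonE finite_Diff finite_HL(4) le_neq_implies_less less_one)
    then show ?thesis
      using that by blast
  qed
  obtain y y' where y: "y \<in> H Y" "y' \<in> H Y" "y \<noteq> y'"
    using two_high(2) by (rule obtain2)
  obtain x where x: "x \<in> H X"
    using two_high(1) by (metis obtain2)
  have ne: "w2 \<noteq> y" "w2 \<noteq> y'" "w3 \<noteq> y" "w3 \<noteq> y'" "x \<noteq> u1" "x \<noteq> u2" "x \<noteq> u3"
    using w y x u by auto
  have cases: "p \<in> H X \<or> p \<in> {u1, u2, u3}" if "p \<in> X" for p
    using that L(1) by auto
  \<comment> \<open>If \<open>p2 = u3\<close>, the two paths chain and one high vertex of
    \<open>Y\<close> closes a 6-cycle; otherwise two high vertices of \<open>Y\<close> join them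
    into an 8-cycle.\<close>
  consider "p3 \<in> H X" "p2 \<in> H X" | "p3 \<in> H X" "p2 = u1" | "p3 \<in> H X" "p2 = u3"
    | "p3 = u1" "p2 \<in> H X" | "p3 = u1" "p2 = u3"
    using cases[OF p(1)] cases[OF p(2)] \<open>p2 \<noteq> p3\<close> p2 p3 by auto
  then show ?thesis
  proof cases
    case 1
    then have "p2 \<noteq> u1" "p2 \<noteq> u3" "p3 \<noteq> u1"
      using u by auto
    then show ?thesis
      using 1 p2 p3 to fro y u d ne \<open>w2 \<noteq> w3\<close> \<open>p2 \<noteq> p3\<close> L LY
      by (intro near_cycI8[of u2 w2 p2 y u3 w3 p3 y' u1 dd]) auto
  next
    case 2
    then have "p3 \<noteq> u1"
      using u by auto
    then show ?thesis
      using 2 p2 p3 to fro u1 y u d ne \<open>w2 \<noteq> w3\<close> \<open>p2 \<noteq> p3\<close> L LY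
      by (intro near_cycI8[of u2 w2 u1 y u3 w3 p3 y' u1 dd]) auto
  next
    case 3
    then have "p3 \<noteq> u1"
      using u by auto
    then show ?thesis
      using 3 p2 p3 to fro u1 y u d ne \<open>w2 \<noteq> w3\<close> \<open>p2 \<noteq> p3\<close> L LY
      by (intro near_cycI6[of u2 w2 u3 w3 p3 y u1 dd]) auto
  next
    case 4
    then have "p2 \<noteq> u1" "p2 \<noteq> u3"
      using u by auto
    then show ?thesis
      using 4 p2 p3 to fro u1 y u d ne \<open>w2 \<noteq> w3\<close> \<open>p2 \<noteq> p3\<close> L LY
      by (intro near_cycI8[of u3 w3 u1 y u2 w2 p2 y' u1 dd]) auto
  next
    case 5
    then show ?thesis
      using p2 p3 to fro u1 y u d ne \<open>w2 \<noteq> w3\<close> \<open>p2 \<noteq> p3\<close> L LY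
      by (intro near_cycI6[of u2 w2 u3 w3 u1 y u1 dd]) auto
  qed
qed

text \<open>Taking \<open>u2\<close>, \<open>u3\<close> and their out-neighbourhoods in a single cut
  yields a path that ends outside \<open>{u2, u3}\<close>. It starts at one of the two, and their
  roles can be exchanged.\<close>

lemma one_exit:
  assumes L: "L X = {u1, u2, u3}" "distinct [u1, u2, u3]"
    and out: "\<And>w. E u2 w \<Longrightarrow> \<not> hi E a w" "\<And>w. E u3 w \<Longrightarrow> \<not> hi E a w"
  shows "near_cyc E a (L X) (L Y)"
proof -
  let ?S = "{u2, u3} \<union> {w. E u2 w} \<union> {w. E u3 w}"
  have u: "u1 \<in> X" "u2 \<in> X" "u3 \<in> X"
    using L(1) by auto
  have "?S \<subseteq> X \<union> Y"
    using u E_XY by auto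
  moreover have "u1 \<notin> ?S"
    using u L(2) E_XY distinct_sides by auto
  ultimately obtain s t where "s \<in> ?S" "t \<notin> ?S" "E s t"
    using strong[of ?S] u by auto
  then consider "E u2 s" "E s t" "t \<noteq> u2" "t \<noteq> u3" | "E u3 s" "E s t" "t \<noteq> u2" "t \<noteq> u3"
    by auto
  then show ?thesis
  proof cases
    case 1
    then show ?thesis
      using L out by (intro one_exit_aux[of u1 u3 u2 s t]) auto
  next
    case 2
    then show ?thesis
      using L out by (intro one_exit_aux[of u1 u2 u3 s t]) auto
  qed
qed

text \<open>No low vertex of \<open>Y\<close> has to be visited, so the two exits and a third high
  vertex of \<open>Y\<close> already close a 6-cycle.\<close>

lemma two_exits_few:
  assumes L: "L X = {u1, u2, u3}" "distinct [u1, u2, u3]" and LY: "L Y \<subseteq> {d}"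
    and y: "y1 \<in> H Y" "y2 \<in> H Y" "E u1 y1" "E u2 y2"
  shows "near_cyc E a (L X) (L Y)"
proof -
  have u: "u1 \<in> L X" "u2 \<in> L X" "u3 \<in> L X"
    using L by auto
  have "card (L Y) \<le> card {d}"
    using LY by (intro card_mono) auto
  then have "3 \<le> card (H Y)"
    using dom_bip.card_HL[OF swap] a_ge_5 by simp
  then obtain y3 where y3: "y3 \<in> H Y" "y3 \<noteq> y1" "y3 \<noteq> y2"
    by (rule obtain_third)
  obtain x where x: "x \<in> H X"
    using two_high(1) by (metis obtain2)
  have "y1 \<noteq> y2"
    using y low_eq[of u1 y1 u2] u L(2) by auto
  moreover have "x \<noteq> u1" "x \<noteq> u2"
    using x u by auto
  ultimately show ?thesis
    using L LY y y3 x u three_low(1,2)[OF L]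
    by (intro near_cycI6[of u1 y1 u2 y2 x y3 u3 d]) auto
qed

text \<open>Two low vertices of each side must be visited. For a >= 6 a third high vertex on each
  side makes room for a 10-cycle through all four exits. For a = 5 only length 8 is left, and an arc
  leaving \<open>{u3, v3}\<close> supplies the shortcut.\<close>

lemma two_exits_both:
  assumes L: "L X = {u1, u2, u3}" "distinct [u1, u2, u3]"
    and M: "L Y = {v1, v2, v3}" "distinct [v1, v2, v3]"
    and y: "y1 \<in> H Y" "y2 \<in> H Y" "E u1 y1" "E u2 y2"
    and x: "x1 \<in> H X" "x2 \<in> H X" "E v1 x1" "E v2 x2"
  shows "near_cyc E a (L X) (L Y)"
proof -
  interpret sw: dom_bip E Y X a by (rule swap)
  have u: "u1 \<in> L X" "u2 \<in> L X" "u3 \<in> L X" and v: "v1 \<in> L Y" "v2 \<in> L Y" "v3 \<in> L Y"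
    using L M by auto
  have yy: "y1 \<noteq> y2" and xx: "x1 \<noteq> x2"
    using y low_eq[of u1 y1 u2] u L(2) x low_eq[of v1 x1 v2] v M(2) by auto
  note Y_all = three_low(1)[OF L] and X_all = sw.three_low(1)[OF M]
  have ne: "x1 \<noteq> u1" "x1 \<noteq> u2" "x1 \<noteq> u3" "x2 \<noteq> u1" "x2 \<noteq> u2" "x2 \<noteq> u3"
    "y1 \<noteq> v1" "y1 \<noteq> v2" "y1 \<noteq> v3" "y2 \<noteq> v1" "y2 \<noteq> v2" "y2 \<noteq> v3"
    using u v x y by auto
  have sides: "u1 \<in> X" "u2 \<in> X" "u3 \<in> X" "v1 \<in> Y" "v2 \<in> Y" "v3 \<in> Y"
    using u v by auto
  have card: "card (H X) = a - 3" "card (H Y) = a - 3"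
    using card_HL sw.card_HL L M by simp_all
  show ?thesis
  proof (cases "a = 5")
    case False
    then have "6 \<le> a"
      using a_ge_5 by simp
    moreover have "3 \<le> card (H X)" "3 \<le> card (H Y)"
      using card \<open>6 \<le> a\<close> by simp_all
    obtain x3 where "x3 \<in> H X" "x3 \<noteq> x1" "x3 \<noteq> x2"
      using \<open>3 \<le> card (H X)\<close> by (rule obtain_third)
    moreover obtain y3 where "y3 \<in> H Y" "y3 \<noteq> y1" "y3 \<noteq> y2"
      using \<open>3 \<le> card (H Y)\<close> by (rule obtain_third)
    moreover have "x3 \<noteq> u1" "x3 \<noteq> u2" "y3 \<noteq> v1" "y3 \<noteq> v2"
      using u v \<open>x3 \<in> H X\<close> \<open>y3 \<in> H Y\<close> by auto
    ultimately show ?thesis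
      using L M sides x y xx yy ne Y_all X_all
      by (intro near_cycI10[of u1 y1 u2 y2 x3 v1 x1 v2 x2 y3 u3 v3]) auto
  next
    case True
    then have HY: "H Y = {y1, y2}" and HX: "H X = {x1, x2}"
      using card y x yy xx card_seteq[of "H Y" "{y1, y2}"] card_seteq[of "H X" "{x1, x2}"] finite_X finite_Y
      by auto
    \<comment> \<open>\<open>y1\<close> and \<open>y2\<close>, now the only high vertices of
      \<open>Y\<close>, are already dominated by the low vertices \<open>u1\<close> and
      \<open>u2\<close>.\<close>
    have u3_out: "w \<in> L Y" if "E u3 w" for w
    proof -
      have "w \<in> Y"
        using that u E_XY by auto
      moreover have "w \<noteq> y1" "w \<noteq> y2"
        using that y u low_eq[of u3 w u1] low_eq[of u3 w u2] L(2) by auto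
      ultimately show ?thesis
        using HY by auto
    qed
    have v3_out: "w \<in> L X" if "E v3 w" for w
    proof -
      have "w \<in> X"
        using that v E_YX by auto
      moreover have "w \<noteq> x1" "w \<noteq> x2"
        using that x v low_eq[of v3 w v1] low_eq[of v3 w v2] M(2) by auto
      ultimately show ?thesis
        using HX by auto
    qed
    have "u1 \<notin> {u3, v3}"
      using L(2) u v distinct_sides by auto
    then obtain s t where "s \<in> {u3, v3}" "t \<notin> {u3, v3}" "E s t"
      using strong[of "{u3, v3}"] u v by auto
    then have "E u3 v1 \<or> E u3 v2 \<or> E v3 u1 \<or> E v3 u2"
      using u3_out v3_out L(1) M(1) by auto
    then consider "E u3 v1" | "E u3 v2" | "E v3 u1" | "E v3 u2"
      by blast
    then show ?thesis
    proof cases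
      case 1
      then show ?thesis
        using L M sides x y xx yy ne Y_all X_all
        by (intro near_cycI8[of u1 y1 u3 v1 x1 v2 x2 y2 u2 v3]) auto
    next
      case 2
      then show ?thesis
        using L M sides x y xx yy ne Y_all X_all
        by (intro near_cycI8[of u1 y1 u3 v2 x2 v1 x1 y2 u2 v3]) auto
    next
      case 3
      then show ?thesis
        using L M sides x y xx yy ne Y_all X_all
        by (intro near_cycI8[of u1 y1 u2 y2 x2 v1 x1 v3 u3 v2]) auto
    next
      case 4
      then show ?thesis
        using L M sides x y xx yy ne Y_all X_all
        by (intro near_cycI8[of u2 y2 u1 y1 x2 v1 x1 v3 u3 v2]) auto
    qed
  qed
qed

text \<open>Visiting one low vertex \<open>v\<close> of \<open>Y\<close> would suffice, as only one
  other exists. \<open>R1\<close>, \<open>R2\<close>, \<open>R3\<close> are the passages through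
  \<open>v\<close> that close up to a near-cycle: from high to another high vertex, from high to a
  low vertex with an exit (the set \<open>?U\<close>), and from low to high. Their absence
  determines the remaining arcs.\<close>

lemma two_exits_two:
  assumes L: "L X = {u1, u2, u3}" "distinct [u1, u2, u3]" and M: "L Y = {v1, v2}" "v1 \<noteq> v2"
    and y: "y1 \<in> H Y" "y2 \<in> H Y" "E u1 y1" "E u2 y2"
    and no: "\<not> near_cyc E a (L X) (L Y)"
  shows "is_d10 E X Y"
proof -
  interpret sw: dom_bip E Y X a by (rule swap)
  have u: "u1 \<in> L X" "u2 \<in> L X" "u3 \<in> L X" and v: "v1 \<in> L Y" "v2 \<in> L Y"
    using L M by auto
  have yy: "y1 \<noteq> y2"
    using y low_eq[of u1 y1 u2] u L(2) by auto
  note Y_all = three_low(1)[OF L] and to_Y = three_low(2)[OF L]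
  have card: "card (H X) = a - 3" "card (H Y) = a - 2"
    using card_HL sw.card_HL L M by simp_all
  have "3 \<le> card (H Y)"
    using card a_ge_5 by simp
  then obtain y3 where y3: "y3 \<in> H Y" "y3 \<noteq> y1" "y3 \<noteq> y2"
    by (rule obtain_third)
  have hilo: "s \<noteq> t" if "s \<in> H S" "t \<in> L T" for s t S T
    using that by auto
  let ?U = "{u \<in> L X. \<exists>y\<in>H Y. E u y}"
  have U: "u1 \<in> ?U" "u2 \<in> ?U"
    using u y by auto
  have LX: "\<exists>c. L X \<subseteq> {s, t, c}" if "s \<in> L X" "t \<in> L X" "s \<noteq> t" for s t
    using that L by auto
  have LY: "\<exists>d. L Y \<subseteq> {v, d}" if "v \<in> L Y" for v
    using that M by auto
  have R1: False if r: "v \<in> L Y" "p \<in> H X" "q \<in> H X" "p \<noteq> q" "E p v" "E v q" for v p q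
  proof -
    obtain d where "L Y \<subseteq> {v, d}"
      using LY r(1) by blast
    then have "near_cyc E a (L X) (L Y)"
      using r L u y yy y3 Y_all to_Y hilo[of y1 Y v Y] hilo[of y2 Y v Y] hilo[of y3 Y v Y]
        hilo[of p X u1 X] hilo[of p X u2 X] hilo[of q X u1 X] hilo[of q X u2 X]
      by (intro near_cycI8[of u1 y1 u2 y2 p v q y3 u3 d]) auto
    then show False
      using no by blast
  qed
  have R2: False if r: "v \<in> L Y" "p \<in> H X" "s \<in> ?U" "E p v" "E v s" for v p s
  proof -
    have "\<exists>t \<in> ?U. t \<noteq> s"
      using U L(2) by auto
    then obtain t where t: "t \<in> ?U" "t \<noteq> s"
      by blast
    obtain ys yt where ys: "ys \<in> H Y" "E s ys" and yt: "yt \<in> H Y" "E t yt"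
      using r(3) t(1) by blast
    obtain c where "L X \<subseteq> {s, t, c}"
      using LX[of s t] r(3) t by auto
    moreover obtain d where "L Y \<subseteq> {v, d}"
      using LY r(1) by blast
    moreover have "ys \<noteq> yt"
      using ys yt r(3) t low_eq[of s ys t] by auto
    ultimately have "near_cyc E a (L X) (L Y)"
      using r t ys yt Y_all to_Y hilo[of ys Y v Y] hilo[of yt Y v Y]
        hilo[of p X s X] hilo[of p X t X]
      by (intro near_cycI6[of s ys t yt p v c d]) auto
    then show False
      using no by blast
  qed
  have R3: False if r: "s \<in> L X" "v \<in> L Y" "q \<in> H X" "E s v" "E v q" for s v q
  proof -
    have "\<exists>t \<in> ?U. t \<noteq> s"
      using U L(2) by auto
    then obtain t where t: "t \<in> ?U" "t \<noteq> s"
      by blast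
    obtain yt where yt: "yt \<in> H Y" "E t yt"
      using t(1) by blast
    obtain y' where y': "y' \<in> H Y" "y' \<noteq> yt"
      using two_high(2) by (rule obtain_other)
    obtain c where "L X \<subseteq> {s, t, c}"
      using LX[of s t] r(1) t by auto
    moreover obtain d where "L Y \<subseteq> {v, d}"
      using LY r(2) by blast
    ultimately have "near_cyc E a (L X) (L Y)"
      using r t yt y' Y_all to_Y hilo[of yt Y v Y] hilo[of y' Y v Y]
        hilo[of q X s X] hilo[of q X t X]
      by (intro near_cycI6[of s v q y' t yt c d]) auto
    then show False
      using no by blast
  qed
  have uU: "s = u3" if "s \<in> L X" "s \<notin> ?U" for s
    using that U L(1) by auto
  have outY: "E s v1 \<or> E s v2" if s: "s \<in> L X" "s \<notin> ?U" for s
  proof -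
    obtain w where "E s w"
      using out_ex[of s] s by auto
    moreover have "w \<in> Y"
      using E_XY \<open>E s w\<close> that by auto
    ultimately have "w \<in> L Y"
      using that by auto
    then show ?thesis
      using M(1) \<open>E s w\<close> by auto
  qed
  have hi_X: "E p v \<or> E p v' \<or> E v'' p" "E v p \<or> E v' p \<or> E p v''"
    if "p \<in> H X" "v \<in> L Y" "v' \<in> L Y" "v'' \<in> L Y" "v \<noteq> v'" for p v v' v''
    using hi_three(1,2)[of p v v' v''] that by auto
  text \<open>A high out-neighbour of a low vertex of \<open>Y\<close> is also its only in-neighbour. If such a pair
    exists, this forces \<open>a = 5\<close> and the arcs of \<open>D10\<close>.\<close>
  have in_nbr: "p = q" if "v \<in> L Y" "q \<in> H X" "E v q" "E p v" for v p q
  proof -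
    have "p \<in> X"
      using that E_YX' by auto
    then show ?thesis
      using R1[of v p q] R3[of p v q] that by auto
  qed
  have in_ex: "E q v" if vq: "v \<in> L Y" "q \<in> H X" "E v q" for v q
  proof -
    have "\<exists>s\<in>(X \<union> Y) - {v}. \<exists>t. t \<notin> (X \<union> Y) - {v} \<and> E s t"
      using u vq distinct_sides by (intro strong) auto
    then obtain s t where "t = v" "E s t"
      using bip by blast
    then show ?thesis
      using in_nbr that by auto
  qed
  have main: "is_d10 E X Y" if v: "L Y = {v, v'}" "v \<noteq> v'" and q: "q \<in> H X" "E v q" for v v' q
  proof -
    have vL: "v \<in> L Y" "v' \<in> L Y"
      using v by auto
    have Eqv: "E q v"
      using in_ex vL q by auto
    \<comment> \<open>Both arcs between \<open>p\<close> and \<open>v\<close> are excluded, which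
      exhausts the budget of \<open>p\<close> and leaves a double arc between \<open>p\<close> and
      \<open>v'\<close>.\<close>
    have other: "E v' p \<and> E p v'" if p: "p \<in> H X" "p \<noteq> q" for p
    proof -
      have "\<not> E p v"
        using in_nbr[of v q p] p q vL by auto
      moreover have "\<not> E v p"
        using R1[of v q p] p q vL Eqv by auto
      ultimately show ?thesis
        using hi_X(1)[of p v v' v] hi_X(2)[of p v v' v] p vL v(2) by auto
    qed
    obtain p where p: "p \<in> H X" "p \<noteq> q"
      using two_high(1) by (rule obtain_other)
    \<comment> \<open>Two such vertices would both have double arcs with \<open>v'\<close>, a
      passage excluded by \<open>R1\<close>. Three low and two high vertices then give a =
      5.\<close>
    have HX: "H X = {q, p}"
    proof -
      have "p' = p" if "p' \<in> H X" "p' \<noteq> q" for p'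
        using other[OF that] other[OF p] R1[of v' p' p] that p vL by auto
      then show ?thesis
        using p q by blast
    qed
    have a5: "a = 5"
      using card(1) p a_ge_5 unfolding HX by simp
    have Eq: "\<not> E q v'" "\<not> E v' q" "\<not> E p v" "\<not> E v p"
      using in_nbr[of v' p q] in_nbr[of v q p] other[OF p] p q vL Eqv low_eq[of v q v'] low_eq[of v' p v] v(2)
      by auto
    have no_in: "\<not> E s w" if "s \<in> L X" "w \<in> L Y" for s w
      using that in_nbr[of v q s] in_nbr[of v' p s] other[OF p] p q vL v(1) by auto
    have all_U: "s \<in> ?U" if "s \<in> L X" for s
      using outY[of s] that no_in M(1) by blast
    have no_out: "\<not> E w s" if "s \<in> L X" "w \<in> L Y" for s w
      using that R2[of v q s] R2[of v' p s] all_U[of s] Eqv other[OF p] p q vL v(1) by auto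
    obtain z3 where z3: "z3 \<in> H Y" "E u3 z3"
      using all_U u by blast
    have zz: "y1 \<noteq> z3" "y2 \<noteq> z3"
      using y z3 low_eq[of u1 y1 u3] low_eq[of u2 y2 u3] u L(2) by auto
    have HY: "H Y = {y1, y2, z3}"
      using card a5 y z3 yy zz finite_Y card_seteq[of "H Y" "{y1, y2, z3}"] by auto
    have X: "X = {u1, u2, u3, q, p}"
      using HX L(1) by auto
    have Y: "Y = {y1, y2, z3, v, v'}"
      using HY v(1) by auto
    have sides: "u1 \<in> X" "u2 \<in> X" "u3 \<in> X" "q \<in> X" "p \<in> X"
      "y1 \<in> Y" "y2 \<in> Y" "z3 \<in> Y" "v \<in> Y" "v' \<in> Y"
      using u p q y z3 vL by simp_all
    have dist: "distinct [u1, u2, u3, q, p, y1, y2, z3, v, v']"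
      using L(2) not_sym[OF p(2)] yy zz v(2) sides
        not_sym[OF hilo[OF q(1) u(1)]] not_sym[OF hilo[OF q(1) u(2)]] not_sym[OF hilo[OF q(1) u(3)]]
        not_sym[OF hilo[OF p(1) u(1)]] not_sym[OF hilo[OF p(1) u(2)]] not_sym[OF hilo[OF p(1) u(3)]]
        hilo[OF y(1) vL(1)] hilo[OF y(2) vL(1)] hilo[OF z3(1) vL(1)]
        hilo[OF y(1) vL(2)] hilo[OF y(2) vL(2)] hilo[OF z3(1) vL(2)]
      by (simp add: distinct_sides)
    have uniq: "\<not> E s z" if "s \<in> L X" "t \<in> L X" "E t z" "s \<noteq> t" for s t z
      using that low_eq by auto
    have unique: "\<not> E u1 y2" "\<not> E u1 z3" "\<not> E u2 y1" "\<not> E u2 z3" "\<not> E u3 y1" "\<not> E u3 y2"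
      using uniq[OF u(1,2) y(4)] uniq[OF u(1,3) z3(2)] uniq[OF u(2,1) y(3)]
        uniq[OF u(2,3) z3(2)] uniq[OF u(3,1) y(3)] uniq[OF u(3,2) y(4)] L(2) by auto
    have "E = d10_arc u1 u2 u3 q p y1 y2 z3 v v'"
    proof (rule eq_d10_arcI[OF dist])
      show "s \<in> {u1, u2, u3, q, p} \<and> t \<in> {y1, y2, z3, v, v'} \<or>
          s \<in> {y1, y2, z3, v, v'} \<and> t \<in> {u1, u2, u3, q, p}" if "E s t" for s t
        using bip[OF that] unfolding X[symmetric] Y[symmetric] by blast
      show "E y1 z \<and> E y2 z \<and> E z3 z" if "z \<in> {u1, u2, u3, q, p}" for z
        using that Y_all[OF y(1)] Y_all[OF y(2)] Y_all[OF z3(1)] unfolding X[symmetric] by blast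
      show "\<not> E s w \<and> \<not> E w s" if "s \<in> {u1, u2, u3}" "w \<in> {v, v'}" for s w
        using that no_in no_out unfolding L(1)[symmetric] v(1)[symmetric] by blast
      show "E q y1" "E q y2" "E q z3" "E p y1" "E p y2" "E p z3"
        using to_Y[OF y(1)] to_Y[OF y(2)] to_Y[OF z3(1)] p(1) q(1) by blast+
    qed (use unique y(3,4) z3(2) Eq Eqv q(2) other[OF p] in blast)+
    then show ?thesis
      unfolding is_d10_def using X Y dist by blast
  qed
  show ?thesis
  proof (cases "\<exists>v\<in>L Y. \<exists>q\<in>H X. E v q")
    case True
    then show ?thesis
      using main[of v1 v2] main[of v2 v1] M by auto
  next
    case False
    \<comment> \<open>Now every out-neighbour of \<open>v\<close> is low, while some high vertex
      dominates \<open>v\<close>. By \<open>R2\<close> such an out-neighbour has no exit, so it is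
      \<open>u3\<close>; but two low vertices cannot both dominate \<open>u3\<close>.\<close>
    have "E v u3" if "v \<in> L Y" for v
    proof -
      obtain p where p: "p \<in> H X"
        using two_high(1) by (metis obtain2)
      have "E p v"
        using hi_X(2)[of p v1 v2 v] M p that False by auto
      obtain s where s: "E v s"
        using out_ex[of v] \<open>v \<in> L Y\<close> by auto
      moreover have "s \<in> L X"
        using s E_YX that False by auto
      moreover have "s \<notin> ?U"
        using R2[of v p s] that p \<open>E p v\<close> s by auto
      ultimately show ?thesis
        using uU by auto
    qed
    then show ?thesis
      using low_eq[of v1 u3 v2] v M by auto
  qed
qed

lemma three_low_case:
  assumes "card (L X) = 3"
  shows "near_cyc E a (L X) (L Y) \<or> is_d10 E X Y"
proof (rule ccontr)
  assume no: "\<not> ?thesis"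
  interpret sw: dom_bip E Y X a by (rule swap)
  \<comment> \<open>If every two of the three low vertices include one with an exit, at most one of
    the three has none.\<close>
  have exits: "\<exists>u1 u2 u3. L S = {u1, u2, u3} \<and> distinct [u1, u2, u3] \<and>
      (\<exists>y\<in>H T. E u1 y) \<and> (\<exists>y\<in>H T. E u2 y)"
    if three: "card (L S) = 3" and one: "\<And>u1 u2 u3. L S = {u1, u2, u3} \<Longrightarrow> distinct [u1, u2, u3] \<Longrightarrow>
        (\<exists>y\<in>H T. E u2 y) \<or> (\<exists>y\<in>H T. E u3 y)" for S T
  proof -
    obtain s1 s2 s3 where s: "L S = {s1, s2, s3}" "s1 \<noteq> s2" "s2 \<noteq> s3" "s1 \<noteq> s3"
      using three unfolding card_3_iff by blast
    let ?e = "\<lambda>u. \<exists>y\<in>H T. E u y"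
    have perm: "L S = {s2, s1, s3}" "L S = {s3, s1, s2}" "L S = {s1, s3, s2}" "L S = {s2, s3, s1}"
      using s(1) by auto
    have "?e s2 \<or> ?e s3" "?e s1 \<or> ?e s3" "?e s1 \<or> ?e s2"
      using one[OF s(1)] one[OF perm(1)] one[OF perm(2)] s by simp_all
    then consider "?e s1" "?e s2" | "?e s1" "?e s3" | "?e s2" "?e s3"
      by blast
    then show ?thesis
    proof cases
      case 1
      then show ?thesis
        using s by (intro exI[of _ s1] exI[of _ s2] exI[of _ s3]) simp
    next
      case 2
      then show ?thesis
        using perm(3) s by (intro exI[of _ s1] exI[of _ s3] exI[of _ s2]) simp
    next
      case 3
      then show ?thesis
        using perm(4) s by (intro exI[of _ s2] exI[of _ s3] exI[of _ s1]) simp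
    qed
  qed
  obtain u1 u2 u3 where L: "L X = {u1, u2, u3}" "distinct [u1, u2, u3]"
    and u: "\<exists>y\<in>H Y. E u1 y" "\<exists>y\<in>H Y. E u2 y"
  proof -
    have "(\<exists>y\<in>H Y. E u2 y) \<or> (\<exists>y\<in>H Y. E u3 y)"
      if "L X = {u1, u2, u3}" "distinct [u1, u2, u3]" for u1 u2 u3
      using one_exit[OF that] no E_XY that by blast
    then show ?thesis
      using exits[of X Y] assms that by blast
  qed
  have "card (L Y) \<le> 3"
    by (rule card_low_le3')
  then consider "card (L Y) \<le> 1" | "card (L Y) = 2" | "card (L Y) = 3"
    by linarith
  then show False
  proof cases
    case 1
    then have "L Y = {} \<or> (\<exists>d. L Y = {d})"
      by (metis card_0_eq card_1_singletonE finite_HL(4) le_neq_implies_less less_one)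
    then obtain d where "L Y \<subseteq> {d}"
      by blast
    then show False
      using two_exits_few[OF L] u no by blast
  next
    case 2
    then obtain v1 v2 where "L Y = {v1, v2}" "v1 \<noteq> v2"
      by (auto simp: card_2_iff)
    then show False
      using two_exits_two[OF L] u no by blast
  next
    case 3
    obtain v1 v2 v3 where M: "L Y = {v1, v2, v3}" "distinct [v1, v2, v3]"
      and v: "\<exists>x\<in>H X. E v1 x" "\<exists>x\<in>H X. E v2 x"
    proof -
      have "(\<exists>x\<in>H X. E v2 x) \<or> (\<exists>x\<in>H X. E v3 x)"
        if "L Y = {v1, v2, v3}" "distinct [v1, v2, v3]" for v1 v2 v3
        using sw.one_exit[OF that] near_cyc_swap no E_YX that by blast
      then show ?thesis
        using exits[of Y X] 3 that by blast
    qed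
    show False
      using two_exits_both[OF L M] u v no by blast
  qed
qed

section \<open>Two low vertices on one side\<close>

lemma no_arc: "u \<in> X \<Longrightarrow> v \<in> X \<Longrightarrow> \<not> E u v"
  using bip disjoint by blast

text \<open>\<open>u1\<close> and \<open>u2\<close> do not both dominate \<open>y\<close>, so at
  least one missing arc is spent on them and at most one other arc at \<open>y\<close> is absent. If
  neither dominates \<open>y\<close>, the budget is exhausted.\<close>

lemma two_low:
  assumes L: "L X = {u1, u2}" "u1 \<noteq> u2" and y: "y \<in> H Y"
  shows "p \<in> X \<Longrightarrow> q \<in> X \<Longrightarrow> p \<noteq> q \<Longrightarrow> E y p \<or> E y q"
    and "p \<in> X \<Longrightarrow> q \<in> H X \<Longrightarrow> E y p \<or> E q y"
    and "p \<in> H X \<Longrightarrow> q \<in> H X \<Longrightarrow> p \<noteq> q \<Longrightarrow> E p y \<or> E q y"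
    and "\<not> E u1 y \<Longrightarrow> \<not> E u2 y \<Longrightarrow> p \<in> X \<Longrightarrow> E y p"
    and "\<not> E u1 y \<Longrightarrow> \<not> E u2 y \<Longrightarrow> p \<in> H X \<Longrightarrow> E p y"
proof -
  interpret sw: dom_bip E Y X a by (rule swap)
  have u: "u1 \<in> L X" "u2 \<in> L X"
    using L by auto
  obtain u where u': "u \<in> L X" "\<not> E u y"
    using low_eq[of u1 y u2] u L(2) by auto
  show "p \<in> X \<Longrightarrow> q \<in> X \<Longrightarrow> p \<noteq> q \<Longrightarrow> E y p \<or> E y q"
    using sw.hi_three(1)[of y p q u] u' y by auto
  show "p \<in> X \<Longrightarrow> q \<in> H X \<Longrightarrow> E y p \<or> E q y"
    using sw.hi_three(2)[of y u q p] u' y by auto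
  show "p \<in> H X \<Longrightarrow> q \<in> H X \<Longrightarrow> p \<noteq> q \<Longrightarrow> E p y \<or> E q y"
    using sw.hi_three(4)[of y p q u] u' y by auto
  show "\<not> E u1 y \<Longrightarrow> \<not> E u2 y \<Longrightarrow> p \<in> X \<Longrightarrow> E y p"
    using sw.hi_three(2)[of y u1 u2 p] u L(2) y by auto
  show "\<not> E u1 y \<Longrightarrow> \<not> E u2 y \<Longrightarrow> p \<in> H X \<Longrightarrow> E p y"
    using sw.hi_three(4)[of y u1 u2 p] u L(2) y by auto
qed

text \<open>Suppose no low vertex has a passage between two different high ones. If \<open>u\<close>
  dominates some high \<open>y1\<close>, no other high vertex dominates \<open>u\<close>. A high
  \<open>y\<close> not dominated by \<open>u\<close> would then be dominated by \<open>u'\<close>,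
  and a third high vertex would have to dominate \<open>u'\<close>, which is a passage. So
  \<open>u\<close> dominates all of \<open>H Y\<close>, and the missing arcs at each high
  \<open>y\<close> are the one to \<open>u\<close> and the one from \<open>u'\<close>. If no low
  vertex dominates a high one, the two arcs from \<open>u1\<close> and \<open>u2\<close> exhaust
  every budget.\<close>

lemma passage_trichotomy:
  assumes L: "L X = {u1, u2}" "u1 \<noteq> u2" and card: "3 \<le> card (H Y)"
  obtains
    (through) u y y' where "u \<in> L X" "y \<in> H Y" "y' \<in> H Y" "y \<noteq> y'" "E y' u" "E u y"
  | (source_sink) u u' where "L X = {u, u'}" "u \<noteq> u'" "\<And>y. y \<in> H Y \<Longrightarrow> E u y \<and> E y u'"
      "\<And>w. E u' w \<Longrightarrow> w \<in> L Y" "\<And>x y. x \<in> H X \<Longrightarrow> y \<in> H Y \<Longrightarrow> E x y \<and> E y x"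
  | (sinks) "\<And>u w. u \<in> L X \<Longrightarrow> E u w \<Longrightarrow> w \<in> L Y" "\<And>u y. u \<in> L X \<Longrightarrow> y \<in> H Y \<Longrightarrow> E y u"
      "\<And>x y. x \<in> H X \<Longrightarrow> y \<in> H Y \<Longrightarrow> E x y \<and> E y x"
proof (cases "\<exists>u\<in>L X. \<exists>y\<in>H Y. \<exists>y'\<in>H Y. y \<noteq> y' \<and> E y' u \<and> E u y")
  case True
  then show ?thesis
    using through by blast
next
  case False
  then have no: "\<not> E y' u" if "u \<in> L X" "y \<in> H Y" "y' \<in> H Y" "y \<noteq> y'" "E u y" for u y y'
    using that by (metis (no_types, lifting))
  show ?thesis
  proof (cases "\<exists>u\<in>L X. \<exists>y\<in>H Y. E u y")
    case False
    then have "\<not> E u1 y" "\<not> E u2 y" if "y \<in> H Y" for y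
      using L(1) that by blast+
    then have to: "E y p" "p \<in> H X \<Longrightarrow> E p y" if "y \<in> H Y" "p \<in> X" for y p
      using two_low(4,5)[OF L that(1)] that by blast+
    have "w \<in> L Y" if "u \<in> L X" "E u w" for u w
      using E_XY that False by blast
    then show ?thesis
      by (rule sinks) (use to in blast)+
  next
    case True
    then obtain u y1 where uy: "u \<in> L X" "y1 \<in> H Y" "E u y1"
      by blast
    have "u \<in> {u1, u2}"
      unfolding L(1)[symmetric] by (rule uy(1))
    then obtain u' where "{u1, u2} = {u, u'}" "u \<noteq> u'"
      using L(2) by auto
    then have L': "L X = {u, u'}" "u \<noteq> u'"
      using L(1) by simp_all
    then have "u' \<in> L X"
      by simp
    then have uX: "u \<in> X" "u' \<in> X" "u' \<in> L X" "\<not> hi E a u" "\<not> hi E a u'"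
      using uy(1) by simp_all
    have all1: "E u y" if y: "y \<in> H Y" "y \<noteq> y1" for y
    proof (rule ccontr)
      assume "\<not> E u y"
      moreover have "\<not> E y u"
        using no[OF uy(1,2) y(1) _ uy(3)] y(2) by simp
      ultimately have "E u' y"
        using two_low(4)[OF L' y(1), of u] uX(1) by blast
      obtain y'' where y'': "y'' \<in> H Y" "y'' \<noteq> y" "y'' \<noteq> y1"
        using card by (rule obtain_third)
      then have "\<not> E y'' u"
        using no[OF uy(1,2) _ _ uy(3)] by simp
      then have "E y'' u'"
        using two_low(1)[OF L' y''(1), of u u'] uX L'(2) by blast
      then show False
        using no[OF uX(3) y(1) y''(1) _ \<open>E u' y\<close>] y''(2) by simp
    qed
    then have all: "E u y" if "y \<in> H Y" for y
      using uy that by blast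
    have none: "\<not> E y u" if "y \<in> H Y" for y
    proof -
      obtain y' where "y' \<in> H Y" "y' \<noteq> y" "y' \<noteq> y"
        using card by (rule obtain_third)
      then show ?thesis
        using no[OF uy(1) _ that _ all] by simp
    qed
    have "E y p" if "y \<in> H Y" "p \<in> X" "p \<noteq> u" for y p
      using two_low(1)[OF L' that(1), of p u] none uX(1) that by blast
    moreover have "E p y" if "y \<in> H Y" "p \<in> H X" for y p
      using two_low(2)[OF L' that(1), of u p] none uX(1) that by blast
    moreover have "w \<in> L Y" if "E u' w" for w
      using low_eq[of u w u'] all uX L'(2) that E_XY[OF that] by blast
    moreover have "x \<in> H X \<Longrightarrow> x \<in> X \<and> x \<noteq> u" for x
      using uX(4) by auto
    ultimately show ?thesis
      using uX all by (intro source_sink[OF L']) blast+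
  qed
qed

text \<open>Only leaving \<open>u'\<close> needs care. The cut around \<open>u'\<close> and its
  out-neighbours gives a path \<open>u'\<close>, \<open>w\<close>, \<open>p\<close> with
  \<open>w\<close> low, and \<open>p\<close> dominates all of \<open>H Y\<close> whether it is high
  or equal to \<open>u\<close>; the cycle may omit \<open>u\<close>.\<close>

lemma source_sink_case:
  assumes L: "L X = {u, u'}" "u \<noteq> u'" and u: "\<And>y. y \<in> H Y \<Longrightarrow> E u y \<and> E y u'"
    and out: "\<And>w. E u' w \<Longrightarrow> w \<in> L Y"
    and HH: "\<And>x y. x \<in> H X \<Longrightarrow> y \<in> H Y \<Longrightarrow> E x y \<and> E y x"
    and card: "card (L Y) \<le> 2"
  shows "near_cyc E a (L X) (L Y)"
proof -
  let ?S = "insert u' {w. E u' w}"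
  have uX: "u \<in> X" "u' \<in> X"
    using L by auto
  have "?S \<subseteq> X \<union> Y"
    using uX E_XY by auto
  moreover have "u \<notin> ?S"
    using L(2) no_arc uX by simp
  ultimately obtain s t where "s \<in> ?S" "t \<notin> ?S" "E s t"
    using strong[of ?S] uX by auto
  then obtain w p where w: "E u' w" "E w p" "p \<noteq> u'"
    by auto
  have wL: "w \<in> L Y"
    using out w by blast
  obtain d where LY: "L Y \<subseteq> {w, d}"
    using card_le_2_subset[OF card _ wL] by auto
  have "p \<in> X"
    using w wL E_YX by auto
  obtain y y' where y: "y \<in> H Y" "y' \<in> H Y" "y \<noteq> y'"
    using two_high(2) by (rule obtain2)
  obtain x where x: "x \<in> H X" "x \<noteq> p"
    using two_high(1) by (rule obtain_other)
  have "p \<in> H X \<or> p \<in> {u, u'}"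
    unfolding L(1)[symmetric] using \<open>p \<in> X\<close> by simp
  then have "E p y"
    using u[OF y(1)] HH[OF _ y(1)] w(3) by blast
  moreover have "u' \<in> L X" "L X \<subseteq> {u', p, x, u}"
    unfolding L(1) by simp_all
  moreover from this have "w \<noteq> y" "w \<noteq> y'" "x \<noteq> u'"
    using wL y x by auto
  ultimately show ?thesis
    using w LY u[OF y(2)] HH[OF x(1) y(1)] HH[OF x(1) y(2)] x(2) uX y(3)
    by (intro near_cycI6[of u' w p y x y' u d]) auto
qed

text \<open>Cutting around both low vertices of \<open>X\<close> and their out-neighbours at once
  ensures that the path found ends in a high vertex.\<close>

lemma sinks_case:
  assumes L: "L X = {u1, u2}" "u1 \<noteq> u2"
    and out: "\<And>u w. u \<in> L X \<Longrightarrow> E u w \<Longrightarrow> w \<in> L Y"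
    and to: "\<And>u y. u \<in> L X \<Longrightarrow> y \<in> H Y \<Longrightarrow> E y u"
    and HH: "\<And>x y. x \<in> H X \<Longrightarrow> y \<in> H Y \<Longrightarrow> E x y \<and> E y x"
    and card: "card (L Y) \<le> 2"
  shows "near_cyc E a (L X) (L Y)"
proof -
  let ?S = "L X \<union> {w. \<exists>u\<in>L X. E u w}"
  obtain x where x: "x \<in> H X"
    using two_high(1) by (metis obtain2)
  have "?S \<subseteq> X \<union> Y"
    using E_XY by auto
  moreover have "x \<notin> ?S"
    using x no_arc by simp
  moreover have "?S \<noteq> {}"
    using L by auto
  ultimately obtain s t where "s \<in> ?S" "t \<notin> ?S" "E s t"
    using strong[of ?S] x by blast
  then obtain u w p where w: "u \<in> L X" "E u w" "E w p" "p \<notin> L X"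
    by blast
  have wL: "w \<in> L Y"
    using out w by blast
  obtain d where LY: "L Y \<subseteq> {w, d}"
    using card_le_2_subset[OF card _ wL] by auto
  obtain c where LX: "L X \<subseteq> {u, c}"
    using pair_cover[OF L(1) w(1)] by blast
  have p: "p \<in> H X"
    using w wL E_YX by auto
  obtain y y' where y: "y \<in> H Y" "y' \<in> H Y" "y \<noteq> y'"
    using two_high(2) by (rule obtain2)
  obtain x where x: "x \<in> H X" "x \<noteq> p"
    using two_high(1) by (rule obtain_other)
  have "w \<noteq> y" "w \<noteq> y'" "x \<noteq> u" "p \<noteq> u"
    using wL y x w by auto
  then show ?thesis
    using w LX LY to[OF w(1) y(2)] HH[OF x(1) y(1)] HH[OF x(1) y(2)] HH[OF p y(1)] x(2) y(3)
    by (intro near_cycI6[of u w p y x y' c d]) auto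
qed

text \<open>The 6-cycle sought is \<open>u\<close>, \<open>y\<close>, \<open>p\<close>,
  \<open>m\<close>, \<open>q\<close>, \<open>y'\<close>. Of three high vertices of \<open>X\<close>,
  \<open>y\<close> dominates at least two and at least two dominate \<open>y'\<close>. At most one
  arc between them and \<open>m\<close> is missing, so it spoils only the choices for
  \<open>p\<close> or only those for \<open>q\<close>. One position keeps two choices and the other
  at least one, hence distinct \<open>p\<close>, \<open>q\<close> exist.\<close>

lemma through_few:
  assumes L: "L X = {u1, u2}" "u1 \<noteq> u2" and LY: "L Y \<subseteq> {d}"
    and u: "u \<in> L X" "y \<in> H Y" "y' \<in> H Y" "y \<noteq> y'" "E y' u" "E u y"
  shows "near_cyc E a (L X) (L Y)"
proof (rule ccontr)
  assume no: "\<not> near_cyc E a (L X) (L Y)"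
  have "card (L Y) \<le> card {d}"
    using LY by (intro card_mono) auto
  then have "card (L X) = 2" "card (L Y) \<le> 1"
    using L by simp_all
  then have "3 \<le> card (H Y)" "3 \<le> card (H X)"
    using card_HL dom_bip.card_HL[OF swap] a_ge_5 by linarith+
  obtain m where m: "m \<in> H Y" "m \<noteq> y" "m \<noteq> y'"
    using \<open>3 \<le> card (H Y)\<close> by (rule obtain_third)
  obtain x1 x2 where x12: "x1 \<in> H X" "x2 \<in> H X" "x1 \<noteq> x2"
    using two_high(1) by (rule obtain2)
  obtain x3 where x3: "x3 \<in> H X" "x3 \<noteq> x1" "x3 \<noteq> x2"
    using \<open>3 \<le> card (H X)\<close> by (rule obtain_third)
  obtain c where LX: "L X \<subseteq> {u, c}"
    using pair_cover[OF L(1) u(1)] by blast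
  have K: "\<not> (E y p \<and> E p m \<and> E m q \<and> E q y')" if pq: "p \<in> H X" "q \<in> H X" "p \<noteq> q" for p q
  proof
    assume "E y p \<and> E p m \<and> E m q \<and> E q y'"
    moreover have "p \<noteq> u" "q \<noteq> u"
      using pq u(1) by auto
    ultimately have "near_cyc E a (L X) (L Y)"
      using u m pq LX LY by (intro near_cycI6[of u y p m q y' c d]) auto
    then show False
      using no by blast
  qed
  note ty = two_low(1)[OF L u(2)] and ty' = two_low(3)[OF L u(3)] and tm = two_low(1-3)[OF L m(1)]
  have "E y x1 \<or> E y x2" "E y x1 \<or> E y x3" "E y x2 \<or> E y x3"
    using ty x12 x3 by blast+
  moreover have "E x1 y' \<or> E x2 y'" "E x1 y' \<or> E x3 y'" "E x2 y' \<or> E x3 y'"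
    using ty' x12 x3 by blast+
  moreover have "E x1 m \<or> E x2 m" "E x1 m \<or> E x3 m" "E x2 m \<or> E x3 m"
    "E m x1 \<or> E m x2" "E m x1 \<or> E m x3" "E m x2 \<or> E m x3"
    using tm(1,3) x12 x3 by blast+
  moreover have "E m p \<or> E q m" if "p \<in> H X" "q \<in> H X" for p q
    using tm(2)[of p q] that by blast
  ultimately show False
    using K[of x1 x2] K[of x2 x1] K[of x1 x3] K[of x3 x1] K[of x2 x3] K[of x3 x2] x12 x3
    by metis
qed

text \<open>The passages \<open>y'\<close>, \<open>u\<close>, \<open>y\<close> and
  \<open>x'\<close>, \<open>v\<close>, \<open>x\<close> join to a 6-cycle by the arcs from
  \<open>y\<close> to \<open>x'\<close> and from \<open>x\<close> to \<open>y'\<close>. If exactly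
  one of these is missing, the budgets of its ends are spent and a detour through \<open>x3\<close>
  and \<open>y3\<close> gives an 8-cycle. If both are missing, a low vertex allows passing from
  \<open>x\<close> to \<open>x'\<close> instead.\<close>

lemma through_both:
  assumes L: "L X = {u1, u2}" "u1 \<noteq> u2" and M: "L Y = {v1, v2}" "v1 \<noteq> v2"
    and u: "u \<in> L X" "y \<in> H Y" "y' \<in> H Y" "y \<noteq> y'" "E y' u" "E u y"
    and v: "v \<in> L Y" "x \<in> H X" "x' \<in> H X" "x \<noteq> x'" "E x' v" "E v x"
  shows "near_cyc E a (L X) (L Y)"
proof (rule ccontr)
  assume no: "\<not> near_cyc E a (L X) (L Y)"
  interpret sw: dom_bip E Y X a by (rule swap)
  have "card (L X) = 2" "card (L Y) = 2"
    using L M by simp_all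
  then have "3 \<le> card (H Y)" "3 \<le> card (H X)"
    using card_HL sw.card_HL a_ge_5 by linarith+
  obtain y3 where y3: "y3 \<in> H Y" "y3 \<noteq> y" "y3 \<noteq> y'"
    using \<open>3 \<le> card (H Y)\<close> by (rule obtain_third)
  obtain x3 where x3: "x3 \<in> H X" "x3 \<noteq> x" "x3 \<noteq> x'"
    using \<open>3 \<le> card (H X)\<close> by (rule obtain_third)
  note tY = two_low(1-3)[OF L] and tX = sw.two_low(1-3)[OF M]
  have uX: "u \<in> X" and vY: "v \<in> Y"
    using u v by auto
  have K: "\<not> (E p t \<and> E t q \<and> E q z \<and> E z u \<and> E u w \<and> E w p)"
    if "t \<in> L Y" "p \<in> H X" "q \<in> H X" "z \<in> H Y" "w \<in> H Y" "p \<noteq> q" "z \<noteq> w" for t p q z w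
  proof
    assume e: "E p t \<and> E t q \<and> E q z \<and> E z u \<and> E u w \<and> E w p"
    obtain c where "L X \<subseteq> {u, c}"
      using pair_cover[OF L(1) u(1)] by blast
    moreover obtain d where "L Y \<subseteq> {t, d}"
      using pair_cover[OF M(1) \<open>t \<in> L Y\<close>] by blast
    moreover have "p \<noteq> u" "q \<noteq> u" "t \<noteq> z" "t \<noteq> w"
      using that u(1) by auto
    ultimately have "near_cyc E a (L X) (L Y)"
      using e that uX by (intro near_cycI6[of u w p t q z c d]) auto
    then show False
      using no by blast
  qed
  have K8: "\<not> (E y p \<and> E p m \<and> E m q \<and> E q z \<and> E z r \<and> E r y')"
    if "{p, q, r} \<subseteq> H X" "{m, z} \<subseteq> H Y \<union> {v}" "p \<noteq> q" "p \<noteq> r" "q \<noteq> r" "m \<noteq> z" "v \<in> {m, z}"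
      "m \<noteq> y" "m \<noteq> y'" "z \<noteq> y" "z \<noteq> y'" for p q r m z
  proof
    assume e: "E y p \<and> E p m \<and> E m q \<and> E q z \<and> E z r \<and> E r y'"
    obtain c where "L X \<subseteq> {u, c}"
      using pair_cover[OF L(1) u(1)] by blast
    moreover obtain d where "L Y \<subseteq> {v, d}"
      using pair_cover[OF M(1) v(1)] by blast
    moreover have "p \<noteq> u" "q \<noteq> u" "r \<noteq> u"
      using that u(1) by auto
    ultimately have "near_cyc E a (L X) (L Y)"
      using e that uX u by (intro near_cycI8[of u y p m q z r y' c d]) auto
    then show False
      using no by blast
  qed
  have vne: "v \<noteq> y" "v \<noteq> y'" "v \<noteq> y3"
    using v u y3 by auto
  consider "E y x'" "E x y'" | "\<not> E y x'" "E x y'" | "E y x'" "\<not> E x y'" | "\<not> E y x'" "\<not> E x y'"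
    by blast
  then show False
  proof cases
    case 1
    then show False
      using K[of v x' x y' y] u v by blast
  next
    case 2
    have yx3: "E y x3"
      using tY(1)[OF u(2), of x' x3] 2 v(3) x3 by blast
    then have "\<not> E x3 v"
      using K[of v x3 x y' y] u v x3 2 by blast
    then have "E x3 y3"
      using tX(1)[OF x3(1), of v y3] vY y3(1) vne by blast
    moreover have "E y3 x'"
      using tX(3)[OF v(3), of y y3] 2 u(2) y3 by blast
    ultimately show False
      using K8[of x3 x' x y3 v] yx3 2 v x3 y3 vne u by blast
  next
    case 3
    have xy3: "E x y3"
      using tX(1)[OF v(2), of y' y3] 3 u(3) y3 by blast
    then have "\<not> E y3 u"
      using K[of v x' x y3 y] u v y3 3 by blast
    then have "E y3 x3"
      using tY(1)[OF y3(1), of u x3] uX x3(1) u(1) by blast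
    moreover have "E x3 y'"
      using tY(3)[OF u(3), of x x3] 3 v(2) x3 by blast
    ultimately show False
      using K8[of x' x x3 v y3] xy3 3 v x3 y3 vne u by blast
  next
    case 4
    \<comment> \<open>If no low vertex of \<open>Y\<close> dominated \<open>x'\<close>, every high
      vertex of \<open>Y\<close> would, including \<open>y\<close>.\<close>
    have "E v1 x' \<or> E v2 x'"
      using sw.two_low(5)[OF M v(3), of y] 4 u(2) by blast
    then obtain t where t: "t \<in> L Y" "E t x'"
      using M(1) by blast
    have "E x t"
      using tX(1)[OF v(2), of y' t] 4 t u(3) by blast
    moreover have "E y x"
      using tY(1)[OF u(2), of x' x] 4 v(2,3,4) by blast
    moreover have "E x' y'"
      using tX(2)[OF v(3), of y' y] 4 u(2,3) by blast
    ultimately show False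
      using K[of t x x' y' y] t u v by blast
  qed
qed

lemma two_low_case:
  assumes "card (L X) = 2" "card (L Y) \<le> 2"
  shows "near_cyc E a (L X) (L Y)"
proof -
  interpret sw: dom_bip E Y X a by (rule swap)
  obtain u1 u2 where L: "L X = {u1, u2}" "u1 \<noteq> u2"
    using assms(1) unfolding card_2_iff by blast
  have card: "3 \<le> card (H X)" "3 \<le> card (H Y)"
    using card_HL sw.card_HL a_ge_5 assms by linarith+
  from L card(2) show ?thesis
  proof (cases rule: passage_trichotomy)
    case (source_sink u u')
    then show ?thesis
      using assms(2) by (rule source_sink_case)
  next
    case sinks
    then show ?thesis
      using sinks_case[OF L _ _ _ assms(2)] by blast
  next
    case u: (through u y y')
    show ?thesis
    proof (cases "card (L Y) = 2")
      case False
      then have "L Y = {} \<or> (\<exists>d. L Y = {d})"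
        using assms(2) by (metis One_nat_def Suc_1 card_0_eq card_1_singletonE finite_HL(4) le_SucE le_zero_eq)
      then obtain d where "L Y \<subseteq> {d}"
        by blast
      then show ?thesis
        using through_few[OF L _ u] by blast
    next
      case True
      then obtain v1 v2 where M: "L Y = {v1, v2}" "v1 \<noteq> v2"
        unfolding card_2_iff by blast
      from M card(1) show ?thesis
      proof (cases rule: sw.passage_trichotomy)
        case (source_sink v v')
        have "card (L X) \<le> 2"
          using assms(1) by simp
        with source_sink have "near_cyc E a (L Y) (L X)"
          by (rule sw.source_sink_case)
        then show ?thesis
          by (rule near_cyc_swap)
      next
        case sinks
        have "card (L X) \<le> 2"
          using assms(1) by simp
        then have "near_cyc E a (L Y) (L X)"
          using sw.sinks_case[OF M] sinks by blast
        then show ?thesis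
          by (rule near_cyc_swap)
      next
        case (through v x x')
        then show ?thesis
          by (rule through_both[OF L M u])
      qed
    qed
  qed
qed

section \<open>At most one low vertex on each side\<close>

text \<open>All arcs between the high vertices of \<open>A\<close> and \<open>B\<close> lead from \<open>B\<close> to \<open>A\<close>; strong connectivity
  provides a way back through low vertices, which is closed up to a 6-cycle.\<close>

lemma one_way:
  assumes LX: "L X \<subseteq> {c}" and LY: "L Y \<subseteq> {d}"
    and H: "H X = AX \<union> BX" "H Y = AY \<union> BY"
    and AA: "\<And>s t. s \<in> AX \<Longrightarrow> t \<in> AY \<Longrightarrow> E s t \<and> E t s"
    and BB: "\<And>s t. s \<in> BX \<Longrightarrow> t \<in> BY \<Longrightarrow> E s t \<and> E t s"
    and BA: "\<And>s t. s \<in> BX \<Longrightarrow> t \<in> AY \<Longrightarrow> E s t" "\<And>s t. s \<in> BY \<Longrightarrow> t \<in> AX \<Longrightarrow> E s t"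
    and AB: "\<And>s t. s \<in> AX \<Longrightarrow> t \<in> BY \<Longrightarrow> \<not> E s t" "\<And>s t. s \<in> AY \<Longrightarrow> t \<in> BX \<Longrightarrow> \<not> E s t"
    and A: "x1 \<in> AX" "x2 \<in> AX" "x1 \<noteq> x2" "y1 \<in> AY" "y2 \<in> AY" "y1 \<noteq> y2"
    and B: "xo \<in> BX" "yo \<in> BY"
  shows "near_cyc E a (L X) (L Y)"
proof -
  let ?A = "AX \<union> AY" and ?B = "BX \<union> BY" and ?L = "L X \<union> L Y"
  have sub: "AX \<subseteq> H X" "BX \<subseteq> H X" "AY \<subseteq> H Y" "BY \<subseteq> H Y"
    using H by auto
  have V: "v \<in> ?A \<union> ?B \<union> ?L" if "v \<in> X \<union> Y" for v
    using that H by blast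
  have other_x: "\<exists>z \<in> AX. z \<noteq> s" and other_y: "\<exists>z \<in> AY. z \<noteq> s" for s
    using A by metis+
  have sides: "AX \<subseteq> X" "BX \<subseteq> X" "AY \<subseteq> Y" "BY \<subseteq> Y"
    using sub by auto
  have AB_disj: "s \<noteq> t" if "s \<in> ?A" "t \<in> ?B" for s t
    using that AA AB B A sides disjoint by blast
  have ne: "s \<noteq> t" if "s \<in> ?A \<union> ?B" "t \<in> ?L" for s t
    using that sub by blast
  have cov: "L X \<subseteq> {s, t, w, c}" "L Y \<subseteq> {s, t, w, d}" for s t w
    using LX LY by auto
  have step1: "near_cyc E a (L X) (L Y)" if k: "k \<in> ?A" "l \<in> ?L" "q \<in> ?B" "E k l" "E l q" for k l q
  proof (cases "l \<in> L X")
    case True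
    then have "k \<in> Y" "q \<in> Y"
      using E_XY'[OF k(4)] E_XY[OF k(5)] by simp_all
    then have kq: "k \<in> AY" "q \<in> BY"
      using k(1,3) sides disjoint by blast+
    obtain y where y: "y \<in> AY" "y \<noteq> k"
      using other_y by blast
    show ?thesis
      using True k kq y A B AA[OF A(1) y(1)] AA[OF A(1) kq(1)] BB[OF B(1) kq(2)] BA(1)[OF B(1) y(1)]
        ne[of xo l] ne[of x1 l] AB_disj[of x1 xo] AB_disj[of k q] AB_disj[of y q]
      by (intro near_cycI6[of l q xo y x1 k, OF _ _ _ _ _ _ _ _ _ cov]) auto
  next
    case False
    then have l: "l \<in> L Y"
      using k by blast
    then have "k \<in> X" "q \<in> X"
      using E_YX'[OF k(4)] E_YX[OF k(5)] by simp_all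
    then have kq: "k \<in> AX" "q \<in> BX"
      using k(1,3) sides disjoint by blast+
    obtain x where x: "x \<in> AX" "x \<noteq> k"
      using other_x by blast
    show ?thesis
      using l k kq x A B AA[OF x(1) A(4)] AA[OF kq(1) A(4)] BB[OF kq(2) B(2)] BA(2)[OF B(2) x(1)]
        ne[of yo l] ne[of y1 l] AB_disj[of y1 yo] AB_disj[of k q] AB_disj[of x q] sub
      by (intro near_cycI6[of k l q yo x y1, OF _ _ _ _ _ _ _ _ _ cov]) auto
  qed
  have step2: "near_cyc E a (L X) (L Y)"
    if k: "k \<in> ?A" "l \<in> ?L" "m \<in> ?L" "q \<in> ?B" "E k l" "E l m" "E m q" for k l m q
  proof (cases "l \<in> L X")
    case True
    then have "k \<in> Y" "m \<in> Y"
      using E_XY'[OF k(5)] E_XY[OF k(6)] by simp_all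
    moreover from this have "q \<in> X"
      using E_YX[OF k(7)] by simp
    ultimately have m: "m \<in> L Y" and kq: "k \<in> AY" "q \<in> BX"
      using k(1,3,4) sides disjoint by blast+
    obtain y where y: "y \<in> AY" "y \<noteq> k"
      using other_y by blast
    show ?thesis
      using True m k kq y A B AA[OF A(1) y(1)] AA[OF A(1) kq(1)] BA(1)[OF kq(2) y(1)]
        ne[of q l] ne[of x1 l] ne[of y m] ne[of k m] AB_disj[of x1 q]
      by (intro near_cycI6[of l m q y x1 k, OF _ _ _ _ _ _ _ _ _ cov]) auto
  next
    case False
    then have l: "l \<in> L Y"
      using k by blast
    then have "k \<in> X" "m \<in> X"
      using E_YX'[OF k(5)] E_YX[OF k(6)] by simp_all
    moreover from this have "q \<in> Y"
      using E_XY[OF k(7)] by simp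
    ultimately have m: "m \<in> L X" and kq: "k \<in> AX" "q \<in> BY"
      using k(1,3,4) sides disjoint by blast+
    obtain x where x: "x \<in> AX" "x \<noteq> k"
      using other_x by blast
    show ?thesis
      using l m k kq x A B AA[OF x(1) A(4)] AA[OF kq(1) A(4)] BA(2)[OF kq(2) x(1)]
        ne[of q l] ne[of y1 l] ne[of x m] ne[of k m] AB_disj[of y1 q] sub
      by (intro near_cycI6[of k l m q x y1, OF _ _ _ _ _ _ _ _ _ cov]) auto
  qed
  have noAB: "\<not> E s t" if "s \<in> ?A" "t \<in> ?B" for s t
    using that AB sides no_arc[of s t] dom_bip.no_arc[OF swap, of s t] by blast
  have xoA: "xo \<notin> ?A \<union> ?L"
    using AB_disj[of _ xo] ne[of xo] B by blast
  have AV: "?A \<subseteq> X \<union> Y" "xo \<in> X \<union> Y"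
    using sub B by blast+
  \<comment> \<open>Leaving \<open>?A\<close> leads to a low \<open>t\<close>, and \<open>?B\<close>
    is entered from a low \<open>l\<close>. If no vertex of \<open>?A\<close> dominates
    \<open>l\<close>, then \<open>t\<close> and \<open>l\<close> are the only low vertices, and the
    cut around \<open>?A\<close> and \<open>t\<close> shows that \<open>t\<close> dominates
    \<open>l\<close> or a vertex of \<open>?B\<close>.\<close>
  have "\<exists>s\<in>?A. \<exists>t. t \<notin> ?A \<and> E s t"
    using AV A xoA by (intro strong) blast+
  then obtain k t where k: "k \<in> ?A" "t \<notin> ?A" "E k t"
    by blast
  then have t: "t \<in> ?L"
    using V[of t] bip noAB by blast
  have "\<exists>s\<in>?A \<union> ?L. \<exists>t. t \<notin> ?A \<union> ?L \<and> E s t"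
    using AV A xoA by (intro strong) blast+
  then obtain l q where l: "l \<in> ?A \<union> ?L" "q \<notin> ?A \<union> ?L" "E l q"
    by blast
  then have q: "q \<in> ?B" and lL: "l \<in> ?L"
    using V[of q] bip noAB by blast+
  show ?thesis
  proof (cases "\<exists>k\<in>?A. E k l")
    case True
    then show ?thesis
      using step1 lL q l(3) by blast
  next
    case False
    then have "t \<noteq> l"
      using k by blast
    have Lcd: "?L \<subseteq> {c, d}"
      using LX LY by auto
    have two: "z = t \<or> z = l" if "z \<in> ?L" for z
      using subsetD[OF Lcd that] subsetD[OF Lcd t] subsetD[OF Lcd lL] \<open>t \<noteq> l\<close> by auto
    have "t \<in> X \<union> Y"
      using t by auto
    then have "insert t ?A \<subseteq> X \<union> Y"
      using AV(1) by simp
    moreover have "xo \<notin> insert t ?A"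
      using xoA t by auto
    ultimately have "\<exists>s\<in>insert t ?A. \<exists>r. r \<notin> insert t ?A \<and> E s r"
      using AV(2) by (intro strong) auto
    then obtain s r where s: "s \<in> insert t ?A" "r \<notin> insert t ?A" "E s r"
      by blast
    have "r \<in> X \<union> Y"
      using bip[OF s(3)] by blast
    then have "r \<in> ?B \<or> r \<in> ?L"
      using V[of r] s(2) by simp
    then have r: "r \<in> ?B \<or> r = l"
      using two[of r] s(2) by blast
    have "s = t"
    proof (rule ccontr)
      assume "s \<noteq> t"
      then have "s \<in> ?A"
        using s(1) by simp
      then show False
        using r noAB[of s r] False s(3) by blast
    qed
    then show ?thesis
      using r step1[OF k(1) t _ k(3)] step2[OF k(1) t lL q k(3) _ l(3)] s(3) by blast
  qed
qed

section \<open>Double arcs between high vertices\<close>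

abbreviation "dbl s t \<equiv> E s t \<and> E t s"

text \<open>Two missing arcs can spoil at most two of the three pairs.\<close>

lemma dbl_three:
  assumes "x \<in> H X" "p \<in> Y" "q \<in> Y" "r \<in> Y" "p \<noteq> q" "p \<noteq> r" "q \<noteq> r"
  shows "dbl x p \<or> dbl x q \<or> dbl x r"
  using hi_three(1,2)[of x p q r] hi_three(1,2)[of x p r q] hi_three(1,2)[of x q r p]
    hi_three(3,4)[of x p q r] assms by auto

text \<open>Removing \<open>s\<close> leaves three candidates. Applied repeatedly, this gives
  minimum degree two in the graph of double arcs on four vertices of each side.\<close>

lemma dbl_other:
  assumes x: "x \<in> H X" and S: "S \<subseteq> Y" "card S = 4" "s \<in> S"
  obtains t where "t \<in> S" "t \<noteq> s" "dbl x t"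
proof -
  have "card (S - {s}) = 3"
    using S card_gt_0_iff[of S] by simp
  then obtain p q r where "S - {s} = {p, q, r}" "p \<noteq> q" "q \<noteq> r" "p \<noteq> r"
    unfolding card_3_iff by blast
  then have pqr: "p \<in> S" "q \<in> S" "r \<in> S" "p \<noteq> s" "q \<noteq> s" "r \<noteq> s" "p \<noteq> q" "q \<noteq> r" "p \<noteq> r"
    by auto
  then show ?thesis
    using dbl_three[of x p q r] x S(1) that[of p] that[of q] that[of r] by blast
qed

text \<open>The graph of double arcs on four high vertices of each side has minimum degree two. If it
  contains no 4-cycle and no 6-cycle, it is an 8-cycle, and each of its chords closes a 6-cycle.\<close>

lemma double_K22:
  assumes card: "4 \<le> card (H X)" "4 \<le> card (H Y)"
    and no6: "\<forall>x1 y1 x2 y2 x3 y3. E x1 y1 \<longrightarrow> E y1 x2 \<longrightarrow> E x2 y2 \<longrightarrow> E y2 x3 \<longrightarrow> E x3 y3 \<longrightarrow>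
      E y3 x1 \<longrightarrow> x1 \<in> X \<longrightarrow> distinct [x1, x2, x3] \<longrightarrow> distinct [y1, y2, y3] \<longrightarrow> False"
  shows "\<exists>x1\<in>H X. \<exists>x2\<in>H X. \<exists>y1\<in>H Y. \<exists>y2\<in>H Y. x1 \<noteq> x2 \<and> y1 \<noteq> y2 \<and>
    dbl x1 y1 \<and> dbl x1 y2 \<and> dbl x2 y1 \<and> dbl x2 y2"
proof (rule ccontr)
  assume neg: "\<not> ?thesis"
  note no = no6[rule_format]
  interpret sw: dom_bip E Y X a by (rule swap)
  obtain S where S: "S \<subseteq> H X" "card S = 4"
    using card(1) obtain_subset_with_card_n by metis
  obtain T where T: "T \<subseteq> H Y" "card T = 4"
    using card(2) obtain_subset_with_card_n by metis
  have fin: "finite S" "finite T"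
    using S T card_gt_0_iff by force+
  have SX: "S \<subseteq> X" and TY: "T \<subseteq> Y"
    using S T by auto
  have nbS: "\<exists>t\<in>T. t \<noteq> s \<and> dbl x t" if "x \<in> S" "s \<in> T" for x s
    using dbl_other[of x T s] S(1) TY T(2) that by blast
  have nbT: "\<exists>t\<in>S. t \<noteq> s \<and> dbl t y" if "y \<in> T" "s \<in> S" for y s
    using sw.dbl_other[of y S s] T(1) SX S(2) that by blast
  have K: False if "x1 \<in> S" "x2 \<in> S" "x1 \<noteq> x2" "y1 \<in> T" "y2 \<in> T" "y1 \<noteq> y2"
    "dbl x1 y1" "dbl x1 y2" "dbl x2 y1" "dbl x2 y2" for x1 x2 y1 y2
    using neg S(1) T(1) that by blast
  have C6: False if "x1 \<in> S" "x2 \<in> S" "x3 \<in> S" "distinct [x1, x2, x3]" "distinct [y1, y2, y3]"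
    "dbl x1 y1" "dbl x2 y1" "dbl x2 y2" "dbl x3 y2" "dbl x3 y3" "dbl x1 y3" for x1 x2 x3 y1 y2 y3
    using no[of x1 y1 x2 y2 x3 y3] SX that by blast
  obtain x1 where x1: "x1 \<in> S"
    using S(2) by fastforce
  obtain t where t: "t \<in> T"
    using T(2) by fastforce
  obtain y1 where y1: "y1 \<in> T" "dbl x1 y1"
    using nbS[OF x1 t] by blast
  obtain y2 where y2: "y2 \<in> T" "y2 \<noteq> y1" "dbl x1 y2"
    using nbS[OF x1 y1(1)] by blast
  obtain x2 where x2: "x2 \<in> S" "x2 \<noteq> x1" "dbl x2 y1"
    using nbT[OF y1(1) x1] by blast
  obtain x3 where x3: "x3 \<in> S" "x3 \<noteq> x1" "dbl x3 y2"
    using nbT[OF y2(1) x1] by blast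
  have "x2 \<noteq> x3"
    using K[of x1 x2 y1 y2] x1 x2 x3 y1 y2 by auto
  obtain y3 where y3: "y3 \<in> T" "y3 \<noteq> y1" "dbl x2 y3"
    using nbS[OF x2(1) y1(1)] by blast
  have "y3 \<noteq> y2"
    using K[of x1 x2 y1 y2] x1 x2 y3 y1 y2 by auto
  obtain y4 where y4: "y4 \<in> T" "y4 \<noteq> y2" "dbl x3 y4"
    using nbS[OF x3(1) y2(1)] by blast
  have "y4 \<noteq> y1"
    using K[of x1 x3 y1 y2] x1 x3 y4 y1 y2 by auto
  have "y4 \<noteq> y3"
    using C6[of x2 x1 x3 y1 y2 y3] x1 x2 x3 y1 y2 y3 y4 \<open>x2 \<noteq> x3\<close> \<open>y3 \<noteq> y2\<close> by auto
  obtain x4 where x4: "x4 \<in> S" "x4 \<noteq> x2" "dbl x4 y3"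
    using nbT[OF y3(1) x2(1)] by blast
  have "x4 \<noteq> x1"
    using K[of x1 x2 y1 y3] x1 x2 x4 y1 y3 by auto
  have "x4 \<noteq> x3"
    using C6[of x2 x1 x3 y1 y2 y3] x1 x2 x3 x4 y1 y2 y3 \<open>x2 \<noteq> x3\<close> \<open>y3 \<noteq> y2\<close> by auto
  obtain x5 where x5: "x5 \<in> S" "x5 \<noteq> x3" "dbl x5 y4"
    using nbT[OF y4(1) x3(1)] by blast
  have "x5 \<noteq> x1"
    using K[of x1 x3 y2 y4] x1 x3 x5 y2 y4 by auto
  have "x5 \<noteq> x2"
    using C6[of x2 x1 x3 y1 y2 y4] x1 x2 x3 x5 y1 y2 y4 \<open>x2 \<noteq> x3\<close> \<open>y4 \<noteq> y1\<close> by auto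
  \<comment> \<open>Only four vertices are available in \<open>S\<close>, so \<open>x5\<close> must
    be \<open>x4\<close>, and the double arcs close the 8-cycle \<open>x1\<close>,
    \<open>y1\<close>, \<open>x2\<close>, \<open>y3\<close>, \<open>x4\<close>, \<open>y4\<close>,
    \<open>x3\<close>, \<open>y2\<close>.\<close>
  have "card {x1, x2, x3, x4} = 4"
    using x2(2) x3(2) x4(2) \<open>x2 \<noteq> x3\<close> \<open>x4 \<noteq> x1\<close> \<open>x4 \<noteq> x3\<close> by simp
  then have "{x1, x2, x3, x4} = S"
    using fin x1 x2(1) x3(1) x4(1) S(2) by (intro card_seteq) auto
  then have "x5 = x4"
    using x5(1,2) \<open>x5 \<noteq> x1\<close> \<open>x5 \<noteq> x2\<close> by blast
  have x1H: "x1 \<in> X" "hi E a x1"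
    using x1 S(1) by auto
  have yY: "y3 \<in> Y" "y4 \<in> Y"
    using y3 y4 TY by auto
  \<comment> \<open>These three arcs are chords of the 8-cycle and cannot all be missing.\<close>
  have "E x1 y3 \<or> E x1 y4 \<or> E y3 x1"
    by (rule hi_three(1)[OF x1H yY]) (use \<open>y4 \<noteq> y3\<close> yY in auto)
  then show False
    using no[of x1 y3 x4 y4 x3 y2] no[of x1 y4 x4 y3 x2 y1] no[of x1 y2 x3 y4 x4 y3] x1H
      x2 x3 x4 x5 y1 y2 y3 y4 \<open>x5 = x4\<close> \<open>x2 \<noteq> x3\<close> \<open>x4 \<noteq> x1\<close> \<open>x4 \<noteq> x3\<close> \<open>y3 \<noteq> y2\<close> \<open>y4 \<noteq> y1\<close> \<open>y4 \<noteq> y3\<close>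
    by auto
qed

text \<open>Without 6-cycles, each high vertex off a double \<open>K\<^sub>2\<^sub>,\<^sub>2\<close> receives no arc from it or sends no
  arc to it; this already accounts for its two missing arcs.\<close>

lemma outside_K22:
  assumes no6: "\<forall>x1 y1 x2 y2 x3 y3. E x1 y1 \<longrightarrow> E y1 x2 \<longrightarrow> E x2 y2 \<longrightarrow> E y2 x3 \<longrightarrow> E x3 y3 \<longrightarrow>
      E y3 x1 \<longrightarrow> x1 \<in> X \<longrightarrow> distinct [x1, x2, x3] \<longrightarrow> distinct [y1, y2, y3] \<longrightarrow> False"
    and card: "4 \<le> card (H Y)"
    and K: "x1 \<in> H X" "x2 \<in> H X" "x1 \<noteq> x2" "y1 \<in> H Y" "y2 \<in> H Y" "y1 \<noteq> y2"
      "dbl x1 y1" "dbl x1 y2" "dbl x2 y1" "dbl x2 y2"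
  shows "\<And>x y. x \<in> H X - {x1, x2} \<Longrightarrow> y \<in> H Y - {y1, y2} \<Longrightarrow> E x y \<Longrightarrow>
      \<not> E y1 x \<and> \<not> E y2 x \<or> \<not> E y x1 \<and> \<not> E y x2"
    and "\<And>x y. x \<in> H X - {x1, x2} \<Longrightarrow> y \<in> H Y - {y1, y2} \<Longrightarrow> E y x \<Longrightarrow>
      \<not> E x1 y \<and> \<not> E x2 y \<or> \<not> E x y1 \<and> \<not> E x y2"
    and "\<And>x. x \<in> H X - {x1, x2} \<Longrightarrow> \<not> E y1 x \<and> \<not> E y2 x \<or> \<not> E x y1 \<and> \<not> E x y2"
proof -
  note no = no6[rule_format]
  interpret sw: dom_bip E Y X a by (rule swap)
  show R1: "\<not> E y1 x \<and> \<not> E y2 x \<or> \<not> E y x1 \<and> \<not> E y x2"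
    if "x \<in> H X - {x1, x2}" "y \<in> H Y - {y1, y2}" "E x y" for x y
    using no[of x y x1 y1 x2 y2] no[of x y x1 y2 x2 y1] no[of x y x2 y1 x1 y2] no[of x y x2 y2 x1 y1]
      that K by auto
  show R2: "\<not> E x1 y \<and> \<not> E x2 y \<or> \<not> E x y1 \<and> \<not> E x y2"
    if "x \<in> H X - {x1, x2}" "y \<in> H Y - {y1, y2}" "E y x" for x y
    using no[of x y1 x1 y2 x2 y] no[of x y1 x2 y2 x1 y] no[of x y2 x1 y1 x2 y] no[of x y2 x2 y1 x1 y]
      that K by auto
  show "\<not> E y1 x \<and> \<not> E y2 x \<or> \<not> E x y1 \<and> \<not> E x y2" if x: "x \<in> H X - {x1, x2}" for x
  proof (rule ccontr)
    assume both: "\<not> ?thesis"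
    \<comment> \<open>If \<open>x\<close> both receives arcs from and sends arcs to the double
      graph, an arc either way between \<open>x\<close> and \<open>y\<close> blocks two arcs at
      \<open>y\<close>; the budget of \<open>y\<close> then forces the opposite arc, which blocks
      two more. So \<open>x\<close> and \<open>y\<close> are nonadjacent, and two such
      \<open>y\<close> cost \<open>x\<close> four arcs.\<close>
    have none: "\<not> E x y" "\<not> E y x" if y: "y \<in> H Y - {y1, y2}" for y
    proof -
      have y': "y \<in> Y" "hi E a y" and x': "x1 \<in> X" "x2 \<in> X" "x \<in> X" "x1 \<noteq> x" "x2 \<noteq> x"
        using y x K by auto
      have "E y x1 \<or> E y x2 \<or> E y x" "E x1 y \<or> E x2 y \<or> E x y"
        using sw.hi_three(3,4)[OF y' x'(1,2) K(3) x'(3)] x' by blast+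
      moreover have "E y x1 \<or> E y x2 \<or> E x1 y" "E x1 y \<or> E x2 y \<or> E y x1"
        "E y x1 \<or> E y x2 \<or> E x2 y" "E x1 y \<or> E x2 y \<or> E y x2"
        using sw.hi_three(1,2)[OF y' x'(1,2) K(3) x'(1)] sw.hi_three(1,2)[OF y' x'(1,2) K(3) x'(2)]
        by blast+
      ultimately show "\<not> E x y" "\<not> E y x"
        using R1[OF x y] R2[OF x y] both by blast+
    qed
    have "card (H Y - {y1, y2}) \<ge> 2"
      using card K by (simp add: card_Diff_subset)
    then obtain y3 y4 where "y3 \<in> H Y - {y1, y2}" "y4 \<in> H Y - {y1, y2}" "y3 \<noteq> y4"
      by (rule obtain2)
    then show False
      using hi_three(1)[of x y3 y4 y3] none[of y3] none[of y4] x by auto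
  qed
qed

lemma few_low_case:
  assumes card_L: "card (L X) \<le> 1" "card (L Y) \<le> 1"
  shows "near_cyc E a (L X) (L Y)"
proof (rule ccontr)
  assume neg: "\<not> near_cyc E a (L X) (L Y)"
  interpret sw: dom_bip E Y X a by (rule swap)
  have card: "4 \<le> card (H X)" "4 \<le> card (H Y)"
    using card_HL sw.card_HL card_L a_ge_5 by linarith+
  have single: "\<exists>c. S \<subseteq> {c}" if "card S \<le> 1" "finite S" for S :: "'a set"
    using that by (metis One_nat_def card_le_Suc0_iff_eq insertI1 insert_absorb insert_subset subsetI subset_singletonD)
  obtain c where c: "L X \<subseteq> {c}"
    using single[OF card_L(1)] by auto
  obtain d where d: "L Y \<subseteq> {d}"
    using single[OF card_L(2)] by auto
  have no: "\<forall>x1 y1 x2 y2 x3 y3. E x1 y1 \<longrightarrow> E y1 x2 \<longrightarrow> E x2 y2 \<longrightarrow> E y2 x3 \<longrightarrow> E x3 y3 \<longrightarrow>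
      E y3 x1 \<longrightarrow> x1 \<in> X \<longrightarrow> distinct [x1, x2, x3] \<longrightarrow> distinct [y1, y2, y3] \<longrightarrow> False"
    using near_cycI6[of _ _ _ _ _ _ c d] c d neg by blast
  have no': "\<forall>y1 x1 y2 x2 y3 x3. E y1 x1 \<longrightarrow> E x1 y2 \<longrightarrow> E y2 x2 \<longrightarrow> E x2 y3 \<longrightarrow> E y3 x3 \<longrightarrow>
      E x3 y1 \<longrightarrow> y1 \<in> Y \<longrightarrow> distinct [y1, y2, y3] \<longrightarrow> distinct [x1, x2, x3] \<longrightarrow> False"
  proof (intro allI impI)
    fix y1 x1 y2 x2 y3 x3
    assume e: "E y1 x1" "E x1 y2" "E y2 x2" "E x2 y3" "E y3 x3" "E x3 y1" "y1 \<in> Y"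
      "distinct [y1, y2, y3]" "distinct [x1, x2, x3]"
    then show False
      using no[rule_format, OF e(2-6,1) E_YX[OF e(1,7)]] by auto
  qed
  obtain x1 x2 y1 y2 where K: "x1 \<in> H X" "x2 \<in> H X" "x1 \<noteq> x2" "y1 \<in> H Y" "y2 \<in> H Y" "y1 \<noteq> y2"
    "dbl x1 y1" "dbl x1 y2" "dbl x2 y1" "dbl x2 y2"
    using double_K22[OF card no] by blast
  let ?BX = "H X - {x1, x2}" and ?BY = "H Y - {y1, y2}"
  note R = outside_K22[OF no card(2) K]
  have K': "dbl y1 x1" "dbl y1 x2" "dbl y2 x1" "dbl y2 x2"
    using K by blast+
  note R' = sw.outside_K22(3)[OF no' card(1) K(4-6) K(1-3) K']
  \<comment> \<open>By the third part of \<open>R\<close> two arcs between \<open>x\<close> and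
    \<open>{y1, y2}\<close> are missing, so \<open>x\<close> has every other arc.\<close>
  have satX: "dbl x y" "\<not> E y1 x \<and> \<not> E y2 x \<Longrightarrow> E x y1 \<and> E x y2" "\<not> E x y1 \<and> \<not> E x y2 \<Longrightarrow> E y1 x \<and> E y2 x"
    if x: "x \<in> ?BX" and y: "y \<in> ?BY" for x y
  proof -
    have x': "x \<in> X" "hi E a x" and y': "y1 \<in> Y" "y2 \<in> Y" "y \<in> Y" "y \<noteq> y1" "y \<noteq> y2"
      using x y K by auto
    note h = hi_three[OF x' y'(1,2) K(6)]
    show "dbl x y" "\<not> E y1 x \<and> \<not> E y2 x \<Longrightarrow> E x y1 \<and> E x y2" "\<not> E x y1 \<and> \<not> E x y2 \<Longrightarrow> E y1 x \<and> E y2 x"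
      using R(3)[OF x] h[OF y'(3)] h[OF y'(1)] h[OF y'(2)] y' by blast+
  qed
  have satY: "\<not> E x1 y \<and> \<not> E x2 y \<Longrightarrow> E y x1 \<and> E y x2" "\<not> E y x1 \<and> \<not> E y x2 \<Longrightarrow> E x1 y \<and> E x2 y"
    if y: "y \<in> ?BY" for y
  proof -
    have y': "y \<in> Y" "hi E a y" and x': "x1 \<in> X" "x2 \<in> X"
      using y K by auto
    note h = sw.hi_three[OF y' x' K(3)]
    show "\<not> E x1 y \<and> \<not> E x2 y \<Longrightarrow> E y x1 \<and> E y x2" "\<not> E y x1 \<and> \<not> E y x2 \<Longrightarrow> E x1 y \<and> E x2 y"
      using h(1,2)[OF x'(1)] h(1,2)[OF x'(2)] by blast+
  qed
  have "2 \<le> card ?BX" "2 \<le> card ?BY"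
    using card K by (simp_all add: card_Diff_subset)
  obtain x3 x4 where x34: "x3 \<in> ?BX" "x4 \<in> ?BX" "x3 \<noteq> x4"
    using \<open>2 \<le> card ?BX\<close> by (rule obtain2)
  obtain y3 y4 where y34: "y3 \<in> ?BY" "y4 \<in> ?BY" "y3 \<noteq> y4"
    using \<open>2 \<le> card ?BY\<close> by (rule obtain2)
  \<comment> \<open>The double arc between \<open>x\<close> and \<open>y\<close> lets
    \<open>R\<close> transfer the direction: the double graph sends nothing to \<open>x\<close> if
    and only if it sends nothing to \<open>y\<close>. Hence one direction holds for all vertices
    outside it, and it plays the part of \<open>A\<close> or of \<open>B\<close> in
    \<open>one_way\<close>.\<close>
  have BX: "\<not> E y1 x \<and> \<not> E y2 x \<longleftrightarrow> \<not> E x1 y \<and> \<not> E x2 y" if x: "x \<in> ?BX" and y: "y \<in> ?BY" for x y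
    using R[OF x] R'[OF y] R(1)[OF x y] R(2)[OF x y] satX[OF x y] satY[OF y] by blast
  have H: "H X = {x1, x2} \<union> ?BX" "H Y = {y1, y2} \<union> ?BY"
    using K by blast+
  show False
  proof (cases "\<not> E y1 x3 \<and> \<not> E y2 x3")
    case True
    then have y_in: "\<not> E x1 y \<and> \<not> E x2 y" if "y \<in> ?BY" for y
      using BX[OF x34(1) that] by blast
    then have x_in: "\<not> E y1 x \<and> \<not> E y2 x" if "x \<in> ?BX" for x
      using BX[OF that y34(1)] y34(1) by blast
    have "near_cyc E a (L X) (L Y)"
    proof (rule one_way[OF c d H])
      show "E s t \<and> E t s" if "s \<in> {x1, x2}" "t \<in> {y1, y2}" for s t
        using that K(7-10) by blast
      show "E s t \<and> E t s" if "s \<in> ?BX" "t \<in> ?BY" for s t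
        using satX(1)[OF that] .
      show "E s t" if "s \<in> ?BX" "t \<in> {y1, y2}" for s t
        using satX(2)[OF that(1) y34(1)] x_in[OF that(1)] that(2) by blast
      show "E s t" if "s \<in> ?BY" "t \<in> {x1, x2}" for s t
        using satY(1)[OF that(1)] y_in[OF that(1)] that(2) by blast
      show "\<not> E s t" if "s \<in> {x1, x2}" "t \<in> ?BY" for s t
        using y_in[OF that(2)] that(1) by blast
      show "\<not> E s t" if "s \<in> {y1, y2}" "t \<in> ?BX" for s t
        using x_in[OF that(2)] that(1) by blast
      show "x1 \<noteq> x2" "y1 \<noteq> y2" "x3 \<in> ?BX" "y3 \<in> ?BY"
        by (rule K x34 y34)+
    qed auto
    then show False
      using neg by blast
  next
    case False
    then have "\<not> (\<not> E x1 y \<and> \<not> E x2 y)" if "y \<in> ?BY" for y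
      using BX[OF x34(1) that] by blast
    then have y_out: "\<not> E y x1 \<and> \<not> E y x2" if "y \<in> ?BY" for y
      using R'[OF that] that by blast
    have "\<not> (\<not> E y1 x \<and> \<not> E y2 x)" if "x \<in> ?BX" for x
      using BX[OF that y34(1)] satY(2)[OF y34(1)] y_out[OF y34(1)] by blast
    then have x_out: "\<not> E x y1 \<and> \<not> E x y2" if "x \<in> ?BX" for x
      using R(3)[OF that] that by blast
    have H': "H X = ?BX \<union> {x1, x2}" "H Y = ?BY \<union> {y1, y2}"
      using H by blast+
    have "near_cyc E a (L X) (L Y)"
    proof (rule one_way[OF c d H'])
      show "E s t \<and> E t s" if "s \<in> {x1, x2}" "t \<in> {y1, y2}" for s t
        using that K(7-10) by blast
      show "E s t \<and> E t s" if "s \<in> ?BX" "t \<in> ?BY" for s t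
        using satX(1)[OF that] .
      show "E s t" if "s \<in> {x1, x2}" "t \<in> ?BY" for s t
        using satY(2)[OF that(2)] y_out[OF that(2)] that(1) by blast
      show "E s t" if "s \<in> {y1, y2}" "t \<in> ?BX" for s t
        using satX(3)[OF that(2) y34(1)] x_out[OF that(2)] that(1) by blast
      show "\<not> E s t" if "s \<in> ?BX" "t \<in> {y1, y2}" for s t
        using x_out[OF that(1)] that(2) by blast
      show "\<not> E s t" if "s \<in> ?BY" "t \<in> {x1, x2}" for s t
        using y_out[OF that(1)] that(2) by blast
      show "x3 \<in> ?BX" "x4 \<in> ?BX" "x3 \<noteq> x4" "y3 \<in> ?BY" "y4 \<in> ?BY" "y3 \<noteq> y4"
        by (rule x34 y34)+
    qed auto
    then show False
      using neg by blast
  qed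
qed

section \<open>Combining the cases\<close>

lemma long_cycle_or_d10_aux:
  assumes "card (L Y) \<le> card (L X)"
  shows "(\<exists>p. cyc E p \<and> length p = 2 * a - 2) \<or> is_d10 E X Y"
proof -
  consider "card (L X) \<le> 1" | "card (L X) = 2" | "card (L X) = 3"
    using card_low_le3 by linarith
  then have "near_cyc E a (L X) (L Y) \<or> is_d10 E X Y"
  proof cases
    case 1
    with assms have "card (L Y) \<le> 1"
      by (rule order_trans)
    with 1 show ?thesis
      using few_low_case by blast
  next
    case 2
    with assms have "card (L Y) \<le> 2"
      by simp
    with 2 show ?thesis
      using two_low_case by blast
  next
    case 3
    then show ?thesis
      by (rule three_low_case)
  qed
  then show ?thesis
    using near_cyc_imp_cyc by blast
qed

lemma long_cycle_or_d10:
  "(\<exists>p. cyc E p \<and> length p = 2 * a - 2) \<or> is_d10 E X Y \<or> is_d10 E Y X"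
proof (cases "card (L Y) \<le> card (L X)")
  case True
  then show ?thesis
    using long_cycle_or_d10_aux by blast
next
  case False
  then show ?thesis
    using dom_bip.long_cycle_or_d10_aux[OF swap] by auto
qed

end

section \<open>Transfer to digraphs\<close>

text \<open>Every vertex has an out-neighbour, and distinct vertices have distinct ones, so the arcs
  form the graph of a permutation; a second orbit would contradict the cut condition.\<close>

lemma unique_in_nbr_cycle:
  fixes E :: "'a \<Rightarrow> 'a \<Rightarrow> bool"
  assumes fin: "finite V" and card: "2 \<le> card V"
    and E: "\<And>u v. E u v \<Longrightarrow> u \<in> V \<and> v \<in> V"
    and strong: "\<And>S. S \<noteq> {} \<Longrightarrow> S \<subseteq> V \<Longrightarrow> S \<noteq> V \<Longrightarrow> \<exists>u\<in>S. \<exists>v. v \<notin> S \<and> E u v"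
    and unique: "\<And>u v w. E u w \<Longrightarrow> E v w \<Longrightarrow> u = v"
  shows "\<exists>f. bij_betw f {..<card V} V \<and>
    (\<forall>u v. E u v \<longleftrightarrow> (\<exists>i<card V. u = f i \<and> v = f (Suc i mod card V)))"
proof -
  define n where "n = card V"
  have "\<exists>w. E v w" if "v \<in> V" for v
  proof -
    have "{v} \<noteq> V"
      using card by auto
    then show ?thesis
      using strong[of "{v}"] that by blast
  qed
  then obtain s where s: "E v (s v)" if "v \<in> V" for v
    by metis
  have inj: "inj_on s V"
    using s unique by (metis inj_onI)
  have "s ` V = V"
    using inj fin s E by (intro card_seteq) (auto simp: card_image)
  then have E_iff: "E u v \<longleftrightarrow> u \<in> V \<and> v = s u" for u v
    using s E unique by (metis imageE)
  obtain v0 where v0: "v0 \<in> V"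
    using card by fastforce
  define f where "f i = (s ^^ i) v0" for i
  have f_Suc: "f (Suc i) = s (f i)" for i
    by (simp add: f_def)
  have f_in: "f i \<in> V" for i
    using v0 s E by (induction i) (auto simp: f_def)
  have closed: "S = V" if S: "S \<noteq> {}" "S \<subseteq> V" "\<And>v. v \<in> S \<Longrightarrow> s v \<in> S" for S
  proof (rule ccontr)
    assume "S \<noteq> V"
    then obtain u v where "u \<in> S" "v \<notin> S" "E u v"
      using strong[OF S(1,2)] by blast
    then show False
      using S(3)[of u] E_iff[of u v] by simp
  qed
  have inj_f: "inj_on f {..<n}"
  proof (rule linorder_inj_onI)
    fix i j
    assume ij: "i < j" "j \<in> {..<n}"
    show "f i \<noteq> f j"
    proof
      assume eq: "f i = f j"
      \<comment> \<open>A repetition closes the first \<open>j\<close> iterates under the successor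
        map, so they already fill \<open>V\<close>, although \<open>j < card V\<close>.\<close>
      have "f ` {..<j} = V"
      proof (rule closed)
        fix v
        assume "v \<in> f ` {..<j}"
        then obtain k where k: "k < j" "v = f k"
          by blast
        show "s v \<in> f ` {..<j}"
        proof (cases "Suc k < j")
          case True
          then show ?thesis
            using k by (auto simp flip: f_Suc)
        next
          case False
          then have "s v = f i"
            using k eq by (metis Suc_lessI f_Suc)
          then show ?thesis
            using ij by auto
        qed
      qed (use f_in ij in auto)
      then have "card V \<le> j"
        using card_image_le[of "{..<j}" f] by simp
      then show False
        using ij by (simp add: n_def)
    qed
  qed auto
  then have img: "f ` {..<n} = V"
    using f_in fin by (intro card_seteq) (auto simp: card_image n_def)
  have "f n = f 0"
  proof -
    have "f n \<in> f ` {..<n}"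
      using f_in img by blast
    then obtain i where i: "i < n" "f n = f i"
      by blast
    \<comment> \<open>Otherwise injectivity of \<open>s\<close> moves the coincidence one step back,
      into the range where \<open>f\<close> is injective.\<close>
    have "i = 0"
    proof (rule ccontr)
      assume "i \<noteq> 0"
      then have "f (n - 1) = f (i - 1)"
        using i inj f_in f_Suc[of "n - 1"] f_Suc[of "i - 1"] by (auto dest: inj_onD)
      then show False
        using inj_f i \<open>i \<noteq> 0\<close> by (auto dest: inj_onD)
    qed
    then show ?thesis
      using i by simp
  qed
  then have "f (Suc i mod n) = s (f i)" if "i < n" for i
    using that f_Suc[of i] by (cases "Suc i = n") auto
  then have "E u v \<longleftrightarrow> (\<exists>i<n. u = f i \<and> v = f (Suc i mod n))" for u v
    using img E_iff by auto
  then show ?thesis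
    using inj_f img by (auto simp: bij_betw_def n_def)
qed

text \<open>Arcs of \<open>with_proj H\<close> are pairs of vertices, so each arc must go to the
  image of its pair of ends; the absence of multiple arcs makes this injective.\<close>

lemma digraph_iso_with_projI:
  assumes "digraph D" "inj_on g (verts D)" "g ` verts D = pverts H"
    and "parcs H = map_prod g g ` arcs_ends D"
  shows "digraph_iso D (with_proj H)"
proof -
  interpret digraph D by fact
  define h where "h = \<lparr>iso_verts = g, iso_arcs = \<lambda>e. (g (tail D e), g (head D e)),
    iso_head = snd, iso_tail = fst\<rparr>"
  have "inj_on (iso_arcs h) (arcs D)"
  proof (rule inj_onI)
    fix e e'
    assume "e \<in> arcs D" "e' \<in> arcs D" "iso_arcs h e = iso_arcs h e'"
    then show "e = e'"
      using assms(2) by (intro no_multi_arcs) (auto simp: h_def arc_to_ends_def dest: inj_onD)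
  qed
  then have "digraph_isomorphism h"
    using assms(2) wf_digraph by (simp add: digraph_isomorphism_def h_def)
  moreover have "with_proj H = app_iso h D"
    using assms(3,4) by (auto simp: app_iso_def with_proj_def h_def arcs_ends_def arc_to_ends_def image_image)
  ultimately show ?thesis
    unfolding digraph_iso_def by blast
qed

lemma digraph_iso_directed_cycleI:
  assumes "digraph D" "bij_betw f {..<n} (verts D)"
    and "\<And>u v. u \<rightarrow>\<^bsub>D\<^esub> v \<longleftrightarrow> (\<exists>i<n. u = f i \<and> v = f (Suc i mod n))"
  shows "digraph_iso D (directed_cycle n)"
  unfolding directed_cycle_def
proof (rule digraph_iso_with_projI)
  let ?g = "inv_into {..<n} f"
  have g: "bij_betw ?g (verts D) {..<n}"
    using assms(2) by (rule bij_betw_inv_into)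
  then show "inj_on ?g (verts D)" "?g ` verts D = pverts \<lparr>pverts = {..<n}, parcs = {(i, Suc i mod n) | i. i < n}\<rparr>"
    by (simp_all add: bij_betw_def)
  have inv: "?g (f i) = i" if "i < n" for i
    using that assms(2) by (simp add: bij_betw_def)
  have "arcs_ends D = (\<lambda>i. (f i, f (Suc i mod n))) ` {..<n}"
    using assms(3) by auto
  then have "map_prod ?g ?g ` arcs_ends D = (\<lambda>i. (?g (f i), ?g (f (Suc i mod n)))) ` {..<n}"
    by (simp add: image_image)
  also have "\<dots> = (\<lambda>i. (i, Suc i mod n)) ` {..<n}"
    by (intro image_cong) (simp_all add: inv)
  finally show "parcs \<lparr>pverts = {..<n}, parcs = {(i, Suc i mod n) | i. i < n}\<rparr> = map_prod ?g ?g ` arcs_ends D"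
    by auto
qed (rule assms(1))

lemma digraph_iso_D10I:
  assumes "digraph D" "verts D = X \<union> Y" "is_d10 (\<lambda>u v. u \<rightarrow>\<^bsub>D\<^esub> v) X Y"
  shows "digraph_iso D D10"
proof -
  obtain u1 u2 u3 p1 p2 y1 y2 y3 v1 v2 where
    XY: "X = {u1, u2, u3, p1, p2}" "Y = {y1, y2, y3, v1, v2}"
    and dist: "distinct [u1, u2, u3, p1, p2, y1, y2, y3, v1, v2]"
    and arc: "(\<lambda>u v. u \<rightarrow>\<^bsub>D\<^esub> v) = d10_arc u1 u2 u3 p1 p2 y1 y2 y3 v1 v2"
    using assms(3) unfolding is_d10_def by blast
  let ?x = D10_vertex.x and ?y = D10_vertex.y
  \<comment> \<open>The default value \<open>?y 4\<close> is the image of \<open>u3\<close>.\<close>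
  define g where "g v = (if v = y1 then ?x 1 else if v = y2 then ?x 2 else if v = y3 then ?x 3
    else if v = v1 then ?x 0 else if v = v2 then ?x 4 else if v = p1 then ?y 0 else if v = p2 then ?y 1
    else if v = u1 then ?y 2 else if v = u2 then ?y 3 else ?y 4)" for v
  have dist': "distinct (rev [u1, u2, u3, p1, p2, y1, y2, y3, v1, v2])"
    using dist by (simp only: distinct_rev)
  have g: "g y1 = ?x 1" "g y2 = ?x 2" "g y3 = ?x 3" "g v1 = ?x 0" "g v2 = ?x 4"
    "g p1 = ?y 0" "g p2 = ?y 1" "g u1 = ?y 2" "g u2 = ?y 3" "g u3 = ?y 4"
    using dist dist' by (simp_all add: g_def)
  have V: "verts D = {u1, u2, u3, p1, p2, y1, y2, y3, v1, v2}"
    using assms(2) XY by auto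
  have "arcs_ends D = {(u, v). d10_arc u1 u2 u3 p1 p2 y1 y2 y3 v1 v2 u v}"
    by (auto simp flip: arc)
  also have "\<dots> = {p1, p2} \<times> {y1, y2, y3} \<union> {y1, y2, y3} \<times> {p1, p2, u1, u2, u3} \<union>
      {(u1, y1), (u2, y2), (u3, y3), (p1, v1), (v1, p1), (p2, v2), (v2, p2)}"
    by (rule set_eqI)
      (simp only: split_paired_all mem_Collect_eq case_prod_conv d10_arc_def Un_iff mem_Sigma_iff disj_assoc)
  finally have ends: "map_prod g g ` arcs_ends D = {?y 0, ?y 1} \<times> {?x 1, ?x 2, ?x 3} \<union>
      {?x 1, ?x 2, ?x 3} \<times> {?y 0, ?y 1, ?y 2, ?y 3, ?y 4} \<union>
      {(?y 2, ?x 1), (?y 3, ?x 2), (?y 4, ?x 3), (?y 0, ?x 0), (?x 0, ?y 0), (?y 1, ?x 4), (?x 4, ?y 1)}"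
    by (simp add: image_Un g insert_Times_insert)
  let ?H = "\<lparr>pverts = ?x ` {0, 1, 2, 3, 4} \<union> ?y ` {0, 1, 2, 3, 4}, parcs =
    (\<Union>i \<in> {1, 2, 3}. \<Union>j \<in> {0, 1}. both_arcs (?x i) (?y j)) \<union> ?x ` {1, 2, 3} \<times> ?y ` {2, 3, 4} \<union>
    both_arcs (?x 4) (?y 1) \<union> both_arcs (?x 0) (?y 0) \<union>
    (\<Union>i \<in> {1, 2, 3}. both_arcs (?x i) (?y (i + 1)))\<rparr>"
  show ?thesis
    unfolding D10_def
  proof (rule digraph_iso_with_projI)
    have "distinct (map g [u1, u2, u3, p1, p2, y1, y2, y3, v1, v2])"
      by (simp add: g)
    then have "inj_on g (set [u1, u2, u3, p1, p2, y1, y2, y3, v1, v2])"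
      by (simp only: distinct_map)
    then show "inj_on g (verts D)"
      unfolding V by (simp only: list.set)
    have "g ` verts D = ?x ` {0, 1, 2, 3, 4} \<union> ?y ` {0, 1, 2, 3, 4}"
      unfolding V by (simp add: g insert_commute)
    then show "g ` verts D = pverts ?H"
      by simp
    have "parcs ?H \<subseteq> map_prod g g ` arcs_ends D"
      unfolding ends by (simp add: both_arcs_def)
    moreover have "map_prod g g ` arcs_ends D \<subseteq> parcs ?H"
      unfolding ends by (simp add: both_arcs_def Times_insert_left)
    ultimately show "parcs ?H = map_prod g g ` arcs_ends D"
      by (rule equalityI)
  qed (rule assms(1))
qed

lemma (in wf_digraph) path_awalk:
  assumes "successively (\<lambda>u v. u \<rightarrow> v) (u # vs)" "u \<in> verts G"
  shows "\<exists>q. awalk u q (last (u # vs)) \<and> awalk_verts u q = u # vs"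
  using assms
proof (induction vs arbitrary: u)
  case Nil
  then show ?case
    by (intro exI[of _ "[]"]) (simp add: awalk_Nil_iff)
next
  case (Cons v vs)
  then obtain e where e: "e \<in> arcs G" "tail G e = u" "head G e = v"
    by (auto simp: arcs_ends_conv)
  then have "v \<in> verts G"
    using head_in_verts by blast
  then obtain q where "awalk v q (last (v # vs))" "awalk_verts v q = v # vs"
    using Cons by auto
  then show ?case
    using e by (intro exI[of _ "e # q"]) (simp add: awalk_Cons_iff)
qed

text \<open>The arcs along \<open>p\<close> followed by the closing arc \<open>e\<close> form a
  closed walk. Its vertex list without the first entry is \<open>vs @ [u]\<close>, a rotation of
  \<open>p\<close>, hence distinct.\<close>

lemma (in wf_digraph) cyc_imp_cycle:
  assumes "cyc (\<lambda>u v. u \<rightarrow> v) p"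
  shows "\<exists>q. cycle q \<and> length q = length p"
proof -
  obtain u vs where p: "p = u # vs"
    using assms by (cases p) (auto simp: cyc_def)
  obtain e where e: "e \<in> arcs G" "tail G e = last p" "head G e = u"
    using assms p by (auto simp: cyc_def arcs_ends_conv)
  have "u \<in> verts G"
    using head_in_verts[OF e(1)] e(3) by simp
  then obtain q where q: "awalk u q (last p)" "awalk_verts u q = u # vs"
    using path_awalk[of u vs] assms p by (auto simp: cyc_def)
  have "awalk (last p) [e] u"
    using e \<open>u \<in> verts G\<close> by (simp add: awalk_Cons_iff awalk_Nil_iff)
  with q(1) have qe: "awalk u (q @ [e]) u"
    by (rule awalk_appendI)
  then have "awalk_verts u (q @ [e]) = u # map (head G) (q @ [e])"
    using awalk_verts_conv'[of u "q @ [e]" u] awalkE[OF qe] by (cases q) (auto simp: awalk_def)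
  moreover have "map (head G) q = vs"
    using q awalk_verts_conv'[of u q "last p"] by (auto simp: awalk_def split: if_splits)
  ultimately have "distinct (tl (awalk_verts u (q @ [e])))"
    using assms p e by (simp add: cyc_def)
  moreover have "length (q @ [e]) = length p"
    using q(2) p length_awalk_verts[of u q] by simp
  ultimately show ?thesis
    using qe unfolding cycle_def by blast
qed

lemma (in digraph) degree_eq:
  "degree G v = card {w. v \<rightarrow> w} + card {w. w \<rightarrow> v}"
proof -
  have "inj_on (head G) (out_arcs G v)" "inj_on (tail G) (in_arcs G v)"
    using no_multi_arcs by (auto simp: inj_on_def arc_to_ends_def)
  moreover have "head G ` out_arcs G v = {w. v \<rightarrow> w}" "tail G ` in_arcs G v = {w. w \<rightarrow> v}"
    by (auto simp: arcs_ends_conv)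
  ultimately show ?thesis
    by (metis card_image degree_def in_degree_def out_degree_def)
qed

lemma (in wf_digraph) strongly_connected_exit:
  assumes "strongly_connected G" "S \<noteq> {}" "S \<subseteq> verts G" "S \<noteq> verts G"
  shows "\<exists>u\<in>S. \<exists>v. v \<notin> S \<and> u \<rightarrow> v"
proof (rule ccontr)
  assume closed: "\<not> ?thesis"
  obtain u v where uv: "u \<in> S" "v \<in> verts G" "v \<notin> S"
    using assms(2-4) by blast
  then have "u \<rightarrow>\<^sup>* v"
    using assms(1,3) unfolding strongly_connected_def by blast
  then have "v \<in> S"
    by (induction rule: reachable_induct) (use closed uv(1) in auto)
  then show False
    using uv by blast
qed

theorem theorem1p7:
  fixes D :: "('a, 'b) pre_digraph" and a :: nat
  assumes "a \<ge> 5"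
    and "digraph D"
    and "strongly_connected D"
    and "balanced_bipartite D"
    and "card (verts D) = 2 * a"
    and "\<not> digraph_iso D (directed_cycle (2 * a))"
    and "\<And>x y. dominating_pair D x y \<Longrightarrow> max (degree D x) (degree D y) \<ge> 2 * a - 2"
  shows "(\<exists>p. pre_digraph.cycle D p \<and> length p = 2 * a - 2) \<or> digraph_iso D D10"
proof -
  interpret digraph D by fact
  let ?E = "\<lambda>u v. u \<rightarrow>\<^bsub>D\<^esub> v"
  obtain X Y where "bipartition D X Y" and "card X = card Y"
    using assms(4) unfolding balanced_bipartite_def by blast
  then have XY: "verts D = X \<union> Y" "X \<inter> Y = {}" "card X = card Y"
    and bip: "\<forall>e\<in>arcs D. (tail D e \<in> X \<and> head D e \<in> Y) \<or> (tail D e \<in> Y \<and> head D e \<in> X)"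
    by (simp_all add: bipartition_def)
  have fin: "finite X" "finite Y"
    using finite_verts unfolding XY(1) by simp_all
  then have card: "card X = a" "card Y = a"
    using assms(5) XY by (simp_all add: card_Un_disjoint)
  note exit = strongly_connected_exit[OF assms(3)]
  have dom: "hi ?E a u \<or> hi ?E a v" if "?E u w" "?E v w" "u \<noteq> v" for u v w
  proof -
    have "dominating_pair D u v"
      unfolding dominating_pair_def using that adj_in_verts by blast
    then have "2 * a - 2 \<le> max (degree D u) (degree D v)"
      by (rule assms(7))
    then show ?thesis
      by (simp add: hi_def degree_eq le_max_iff_disj)
  qed
  have ex_hi: "\<exists>v\<in>X \<union> Y. hi ?E a v"
  proof (rule ccontr)
    assume "\<not> ?thesis"
    \<comment> \<open>Without a high vertex, \<open>dom\<close> says that in-neighbours are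
      unique.\<close>
    then have "u = v" if "?E u w" "?E v w" for u v w
      using dom[OF that] that adj_in_verts XY(1) by blast
    moreover have "2 \<le> card (verts D)"
      using assms(1,5) by simp
    ultimately obtain f where "bij_betw f {..<card (verts D)} (verts D)"
      "\<forall>u v. ?E u v \<longleftrightarrow> (\<exists>i<card (verts D). u = f i \<and> v = f (Suc i mod card (verts D)))"
      using unique_in_nbr_cycle[of "verts D" ?E] finite_verts adj_in_verts exit by blast
    then show False
      using digraph_iso_directed_cycleI[OF assms(2), of f] assms(5,6) by simp
  qed
  interpret dom_bip ?E X Y a
  proof
    show "u \<in> X \<and> v \<in> Y \<or> u \<in> Y \<and> v \<in> X" if "?E u v" for u v
    proof -
      obtain e where "e \<in> arcs D" "tail D e = u" "head D e = v"
        using \<open>?E u v\<close> by (auto simp: arcs_ends_conv)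
      then show ?thesis
        using bip by blast
    qed
    show "\<exists>u\<in>S. \<exists>v. v \<notin> S \<and> ?E u v" if "S \<noteq> {}" "S \<subseteq> X \<union> Y" "S \<noteq> X \<union> Y" for S
      using exit[of S] that XY(1) by simp
  qed (fact fin card assms(1) XY(2) dom ex_hi)+
  from long_cycle_or_d10 show ?thesis
  proof (elim disjE exE conjE)
    fix p
    assume "cyc ?E p" "length p = 2 * a - 2"
    then show ?thesis
      using cyc_imp_cycle[of p] by auto
  next
    assume "is_d10 ?E X Y"
    then show ?thesis
      using digraph_iso_D10I[OF assms(2) XY(1)] by blast
  next
    assume "is_d10 ?E Y X"
    then show ?thesis
      using digraph_iso_D10I[OF assms(2), of Y X] XY(1) by (simp add: Un_commute)
  qed
qed

end
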